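(* Let $n\ge4$, $r=\lfloor\frac{n+2}{2}\rfloor$, let $\mathbb{F}$ be a field with $\mathrm{char}(\mathbb{F})=0$ or $\mathrm{char}(\mathbb{F})\ge r$, and let $E$ be a symplectic vector space of dimension $2n$ over $\mathbb{F}$. Then the matrix $B_{L(n,E)}$ is diagonal by blocks (up to permutation of rows and columns and up to zero columns, it is a direct sum of copies of the matrices $\mathcal{L}_k$ with $2\le k\le r$), and it is the unique matrix, up to change of basis, that annuls the rational points of the Lagrangian-Grassmannian variety: $B_{L(n,E)}$ annuls the rational points of $L(n,E)$, and if $H$ is any matrix over $\mathbb{F}$ of order $C^{2n}_{n-2}\times C^{2n}_n$ and maximum rank that annuls the rational points of $L(n,E)$, then $H=P\,B_{L(n,E)}$ for some invertible matrix $P$.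
   Context: $C^a_b$ denotes the binomial coefficient and $I(\ell,m)=\{(\alpha_1,\ldots,\alpha_\ell)\in\mathbb{N}^\ell:1\le\alpha_1<\cdots<\alpha_\ell\le m\}$, whose elements are identified with their underlying sets. $E$ has a nondegenerate alternating form $\langle\,,\rangle$ and a basis $e_1,\ldots,e_{2n}$ with, for $i<j$, $\langle e_i,e_j\rangle=1$ if $j=2n-i+1$ and $0$ otherwise. For $\alpha\in I(n,2n)$ put $e_\alpha=e_{\alpha_1}\wedge\cdots\wedge e_{\alpha_n}$; the Plücker coordinates of $w=\sum_\alpha P_\alpha e_\alpha\in\bigwedge^nE$ are the $P_\alpha$. The Lagrangian-Grassmannian $L(n,E)$ is the set of points $v_1\wedge\cdots\wedge v_n\in\mathbb{P}(\bigwedge^nE)$ with $v_1,\ldots,v_n$ linearly independent and $\langle v_i,v_j\rangle=0$ for all $i,j$; its rational points are those with $v_1,\ldots,v_n\in E$ (i.e. coming from Lagrangian subspaces of $E$ over $\mathbb{F}$). A matrix $H$ with columns indexed by $I(n,2n)$ annuls the rational points if $H(P_\beta)_\beta=0$ for the Plücker vector of every rational point. For $\alpha\in I(n-2,2n)$ let $\Pi_\alpha=\sum_{i=1}^n c_{i,\alpha,2n-i+1}X_{i,\alpha,2n-i+1}$, where $c_{i,\alpha,2n-i+1}=1$ if $|\alpha\cup\{i,2n-i+1\}|=n$ and $0$ otherwise, and $X_{i,\alpha,2n-i+1}$ is the variable indexed by the ordered index $\alpha\cup\{i,2n-i+1\}\in I(n,2n)$. $B_{L(n,E)}$ is the $C^{2n}_{n-2}\times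 C^{2n}_n$ coefficient matrix of the system $\{\Pi_\alpha=0:\alpha\in I(n-2,2n)\}$. For $k\ge2$ and $m=2k-2$, $\mathcal{L}_k$ is the $(0,1)$-matrix with rows indexed by the $\frac{m-2}{2}$-subsets and columns by the $\frac m2$-subsets of an $m$-element set, lexicographically ordered, with entry $1$ exactly when the row subset is contained in the column subset.
   Formalization: The Plücker coordinates are taken with the factors of e_α in the order 1, 2n, 2, 2n−1, …, n, n+1 instead of increasing order, which changes some signs; with increasing order the 0/1 matrix B_{L(n,E)} does not annul the rational points. *)

theory Defs
  imports
    "Jordan_Normal_Form.DL_Rank"
    "HOL-Computational_Algebra.Computational_Algebra"
begin

text \<open>Index sets. The list \<open>index_list l m\<close> enumerates \<open>I(l,m)\<close> in lexicographic order:
  \<open>subseqs\<close> puts the sublists containing the head before those avoiding it. It fixes the order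
  of the rows and columns of all matrices below.\<close>

definition index_list :: "nat \<Rightarrow> nat \<Rightarrow> nat list list" where
  "index_list l m = filter (\<lambda>\<alpha>. length \<alpha> = l) (subseqs [1..<m + 1])"

definition index_set :: "nat \<Rightarrow> nat \<Rightarrow> nat set set" where
  "index_set l m = {\<alpha>. \<alpha> \<subseteq> {1..m} \<and> card \<alpha> = l}"

lemma length_index_list: "length (index_list l m) = m choose l"
proof -
  have *: "length (filter (\<lambda>\<alpha>. length \<alpha> = l) (subseqs xs)) = length xs choose l" for xs :: "nat list"
  proof (induction xs arbitrary: l)
    case Nil
    then show ?case by (cases l) auto
  next
    case (Cons x xs)
    then show ?case
      using Cons.IH[of 0] by (cases l) (auto simp: Let_def filter_map o_def)
  qed
  show ?thesis unfolding index_list_def * by (simp del: upt_Suc)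
qed

lemma set_index_list:
  "set (index_list l m) = {\<alpha>. sorted_wrt (<) \<alpha> \<and> set \<alpha> \<subseteq> {1..m} \<and> length \<alpha> = l}"
proof -
  have *: "set (subseqs xs) = {ys. sorted_wrt (<) ys \<and> set ys \<subseteq> set xs}"
    if "sorted_wrt (<) xs" for xs :: "nat list"
    using that
  proof (induction xs)
    case Nil
    then show ?case by auto
  next
    case (Cons x xs)
    have IH: "set (subseqs xs) = {ys. sorted_wrt (<) ys \<and> set ys \<subseteq> set xs}"
      using Cons by simp
    show ?case
    proof (intro equalityI subsetI)
      fix ys assume "ys \<in> set (subseqs (x # xs))"
      then show "ys \<in> {ys. sorted_wrt (<) ys \<and> set ys \<subseteq> set (x # xs)}"
        using Cons.prems by (auto 4 4 simp: Let_def IH)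
    next
      fix ys assume ys: "ys \<in> {ys. sorted_wrt (<) ys \<and> set ys \<subseteq> set (x # xs)}"
      show "ys \<in> set (subseqs (x # xs))"
      proof (cases ys)
        case Nil
        then show ?thesis by (simp add: Let_def IH)
      next
        case (Cons y zs)
        then show ?thesis
          using ys \<open>sorted_wrt (<) (x # xs)\<close>
          by (fastforce simp: Let_def IH image_iff)
      qed
    qed
  qed
  have "sorted_wrt (<) [1..<m + 1]" by (rule sorted_wrt_upt)
  from *[OF this] show ?thesis unfolding index_list_def by auto
qed

lemma index_list_lexicographic:
  "sorted_wrt (\<lambda>\<alpha> \<beta>. (\<alpha>, \<beta>) \<in> lexord {(i, j). i < j}) (index_list l m)"
proof -
  have *: "sorted_wrt (\<lambda>\<alpha> \<beta>. (\<alpha>, \<beta>) \<in> lexord {(i, j). i < j})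
      (filter (\<lambda>\<alpha>. length \<alpha> = l) (subseqs xs))"
    if "sorted_wrt (<) xs" for xs :: "nat list"
    using that
  proof (induction xs arbitrary: l)
    case Nil
    then show ?case by auto
  next
    case (Cons x xs)
    have heads: "set \<beta> \<subseteq> set xs" if "\<beta> \<in> set (subseqs xs)" for \<beta>
      using that subseqs_powset[of xs] by (metis PowD imageI)
    show ?case
    proof (cases l)
      case 0
      have "sorted_wrt (\<lambda>\<alpha> \<beta>. (\<alpha>, \<beta>) \<in> lexord {(i, j). i < j})
          (filter (\<lambda>\<alpha>. length \<alpha> = 0) (subseqs xs))"
        using Cons.IH[of 0] Cons.prems by simp
      with 0 show ?thesis by (simp add: Let_def filter_map o_def)
    next
      case (Suc k)
      have "(x # \<alpha>, \<beta>) \<in> lexord {(i, j). i < j}"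
        if "\<beta> \<in> set (subseqs xs)" "length \<beta> = Suc k" for \<alpha> \<beta>
        using heads[OF that(1)] that(2) Cons.prems by (cases \<beta>) simp_all
      then show ?thesis
        using Cons.IH[of k] Cons.IH[of "Suc k"] Cons.prems Suc
        by (auto simp: Let_def filter_map o_def sorted_wrt_append sorted_wrt_map)
    qed
  qed
  have "sorted_wrt (<) [1..<m + 1]" by (rule sorted_wrt_upt)
  from *[OF this] show ?thesis unfolding index_list_def .
qed


locale symplectic_space = vector_space scale
  for scale :: "'a::field \<Rightarrow> 'e::ab_group_add \<Rightarrow> 'e" +
  fixes n :: nat
    and \<omega> :: "'e \<Rightarrow> 'e \<Rightarrow> 'a"
    and e :: "nat \<Rightarrow> 'e"
  assumes linear_right: "\<And>x. Vector_Spaces.linear scale (*) (\<lambda>y. \<omega> x y)"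
    and linear_left: "\<And>y. Vector_Spaces.linear scale (*) (\<lambda>x. \<omega> x y)"
    and alternating: "\<And>x. \<omega> x x = 0"
    and nondegenerate: "\<And>x. (\<And>y. \<omega> x y = 0) \<Longrightarrow> x = 0"
    and basis_inj: "inj_on e {1..2 * n}"
    and basis_independent: "independent (e ` {1..2 * n})"
    and basis_span: "span (e ` {1..2 * n}) = UNIV"
    and basis_form: "\<And>i j. 1 \<le> i \<Longrightarrow> i < j \<Longrightarrow> j \<le> 2 * n \<Longrightarrow>
      \<omega> (e i) (e j) = (if j = 2 * n - i + 1 then 1 else 0)"

text \<open>The exterior power \<open>\<Lambda>\<^sup>k E\<close> of a finite-dimensional space is realised as the dual of the
  space of alternating \<open>k\<close>-linear forms on \<open>E\<close>; the vector \<open>v\<^sub>1 \<and> \<dots> \<and> v\<^sub>k\<close> is evaluation at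
  \<open>(v\<^sub>1, \<dots>, v\<^sub>k)\<close>.\<close>

definition alternating_form ::
  "('a::field \<Rightarrow> 'e::ab_group_add \<Rightarrow> 'e) \<Rightarrow> nat \<Rightarrow> ('e list \<Rightarrow> 'a) \<Rightarrow> bool" where
  "alternating_form scale k \<phi> \<longleftrightarrow>
     (\<forall>v i. length v = k \<longrightarrow> i < k \<longrightarrow> Vector_Spaces.linear scale (*) (\<lambda>x. \<phi> (v[i := x]))) \<and>
     (\<forall>v i j. length v = k \<longrightarrow> i < j \<longrightarrow> j < k \<longrightarrow> v ! i = v ! j \<longrightarrow> \<phi> v = 0)"

definition wedge ::
  "('a::field \<Rightarrow> 'e::ab_group_add \<Rightarrow> 'e) \<Rightarrow> 'e list \<Rightarrow> ('e list \<Rightarrow> 'a) \<Rightarrow> 'a" where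
  "wedge scale v = (\<lambda>\<phi>. if alternating_form scale (length v) \<phi> then \<phi> v else 0)"

text \<open>Sign convention. The factors of \<open>e\<^sub>\<alpha>\<close> are taken in the order
  \<open>1, 2n, 2, 2n-1, \<dots>, n, n+1\<close>, which keeps \<open>e\<^sub>i\<close> next to \<open>e\<^bsub>2n-i+1\<^esub>\<close>; so \<open>e\<^sub>\<alpha>\<close> agrees up to
  sign with the product in increasing order. With increasing order the relations
  \<open>\<Pi>\<^sub>\<alpha> = 0\<close>, all of whose coefficients are 0 or 1, would not hold on Lagrangian subspaces: for
  \<open>n = 4\<close> the span of \<open>e\<^sub>2\<close>, \<open>e\<^sub>4\<close>, \<open>e\<^sub>1 + e\<^sub>6\<close>, \<open>e\<^sub>3 + e\<^sub>8\<close> is Lagrangian and both coordinates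
  occurring in \<open>\<Pi>\<close> for the index \<open>{2,4}\<close> (those at \<open>{1,2,4,8}\<close> and \<open>{2,3,4,6}\<close>) would be 1.\<close>

definition pair_order :: "nat \<Rightarrow> nat list" where
  "pair_order n = concat (map (\<lambda>i. [i, 2 * n - i + 1]) [1..<n + 1])"

definition basis_wedge ::
  "('a::field \<Rightarrow> 'e::ab_group_add \<Rightarrow> 'e) \<Rightarrow> nat \<Rightarrow> (nat \<Rightarrow> 'e) \<Rightarrow> nat set
    \<Rightarrow> ('e list \<Rightarrow> 'a) \<Rightarrow> 'a" where
  "basis_wedge scale n e \<alpha> = wedge scale (map e (filter (\<lambda>j. j \<in> \<alpha>) (pair_order n)))"

text \<open>The coordinates of a vector of \<open>\<Lambda>\<^sup>n E\<close> in the basis of the \<open>e\<^sub>\<alpha>\<close>.\<close>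

definition plucker_coords ::
  "('a::field \<Rightarrow> 'e::ab_group_add \<Rightarrow> 'e) \<Rightarrow> nat \<Rightarrow> (nat \<Rightarrow> 'e) \<Rightarrow> (('e list \<Rightarrow> 'a) \<Rightarrow> 'a)
    \<Rightarrow> nat set \<Rightarrow> 'a" where
  "plucker_coords scale n e w = (THE P. (\<forall>\<alpha>. \<alpha> \<notin> index_set n (2 * n) \<longrightarrow> P \<alpha> = 0) \<and>
     w = (\<lambda>\<phi>. \<Sum>\<alpha>\<in>index_set n (2 * n). P \<alpha> * basis_wedge scale n e \<alpha> \<phi>))"

definition plucker_vec ::
  "('a::field \<Rightarrow> 'e::ab_group_add \<Rightarrow> 'e) \<Rightarrow> nat \<Rightarrow> (nat \<Rightarrow> 'e) \<Rightarrow> (('e list \<Rightarrow> 'a) \<Rightarrow> 'a)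
    \<Rightarrow> 'a vec" where
  "plucker_vec scale n e w =
     vec ((2 * n) choose n) (\<lambda>b. plucker_coords scale n e w (set (index_list n (2 * n) ! b)))"

text \<open>The rational points of \<open>L(n,E)\<close>, given by all their representatives in \<open>\<Lambda>\<^sup>n E\<close>: rescaling
  \<open>v\<^sub>1\<close> yields every nonzero multiple of \<open>v\<^sub>1 \<and> \<dots> \<and> v\<^sub>n\<close>, so this set is the cone over
  the rational points, without its vertex.\<close>

definition rational_points ::
  "('a::field \<Rightarrow> 'e::ab_group_add \<Rightarrow> 'e) \<Rightarrow> nat \<Rightarrow> ('e \<Rightarrow> 'e \<Rightarrow> 'a)
    \<Rightarrow> (('e list \<Rightarrow> 'a) \<Rightarrow> 'a) set" where
  "rational_points scale n \<omega> = {wedge scale v | v.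
     length v = n \<and> distinct v \<and> \<not> module.dependent scale (set v) \<and>
     (\<forall>x\<in>set v. \<forall>y\<in>set v. \<omega> x y = 0)}"

definition annuls_rational_points ::
  "('a::field \<Rightarrow> 'e::ab_group_add \<Rightarrow> 'e) \<Rightarrow> nat \<Rightarrow> ('e \<Rightarrow> 'e \<Rightarrow> 'a) \<Rightarrow> (nat \<Rightarrow> 'e)
    \<Rightarrow> 'a mat \<Rightarrow> bool" where
  "annuls_rational_points scale n \<omega> e H \<longleftrightarrow>
     (\<forall>w\<in>rational_points scale n \<omega>. H *\<^sub>v plucker_vec scale n e w = 0\<^sub>v (dim_row H))"

text \<open>The linear form \<open>\<Pi>\<^sub>\<alpha>\<close>, as a function of the variables \<open>X\<close>, and the coefficient matrix of
  these forms.\<close>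

definition Pi_coeff :: "nat \<Rightarrow> nat set \<Rightarrow> nat \<Rightarrow> 'a::field" where
  "Pi_coeff n \<alpha> i = (if card (\<alpha> \<union> {i, 2 * n - i + 1}) = n then 1 else 0)"

definition Pi_form :: "nat \<Rightarrow> nat set \<Rightarrow> (nat set \<Rightarrow> 'a::field) \<Rightarrow> 'a" where
  "Pi_form n \<alpha> X = (\<Sum>i = 1..n. Pi_coeff n \<alpha> i * X (\<alpha> \<union> {i, 2 * n - i + 1}))"

definition B_LG :: "nat \<Rightarrow> 'a::field mat" where
  "B_LG n = mat ((2 * n) choose (n - 2)) ((2 * n) choose n)
     (\<lambda>(a, b). Pi_form n (set (index_list (n - 2) (2 * n) ! a))
       (\<lambda>\<gamma>. if \<gamma> = set (index_list n (2 * n) ! b) then 1 else 0))"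

definition L_mat :: "nat \<Rightarrow> 'a::field mat" where
  "L_mat k = (let m = 2 * k - 2 in
     mat (m choose ((m - 2) div 2)) (m choose (m div 2))
       (\<lambda>(a, b). if set (index_list ((m - 2) div 2) m ! a) \<subseteq> set (index_list (m div 2) m ! b)
                 then 1 else 0))"

text \<open>The summand \<open>0\<^sub>m 0 z\<close> below has no rows, so it appends \<open>z\<close> zero columns.\<close>

definition direct_sum_of_L :: "nat list \<Rightarrow> nat \<Rightarrow> 'a::field mat" where
  "direct_sum_of_L ks z = diag_block_mat (map L_mat ks @ [0\<^sub>m 0 z])"

definition equal_up_to_permutation :: "'a mat \<Rightarrow> 'a mat \<Rightarrow> bool" where
  "equal_up_to_permutation A A' \<longleftrightarrow>
     (\<exists>\<sigma> \<tau>. \<sigma> permutes {..<dim_row A} \<and> \<tau> permutes {..<dim_col A} \<and>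
       A' = mat (dim_row A) (dim_col A) (\<lambda>(a, b). A $$ (\<sigma> a, \<tau> b)))"

end

theory Submission
  imports Defs
begin

text \<open>Write \<open>i' = 2n - i + 1\<close>. An index set \<open>\<beta>\<close> splits as a set \<open>S\<close> without pairs \<open>{i, i'}\<close> and
  the union of the pairs with \<open>i \<in> T\<close>; the relations \<open>\<Pi>\<^sub>\<alpha>\<close> preserve \<open>S\<close> and connect \<open>T\<close> with
  its subsets of one element less, which gives the blocks \<open>\<L>\<^sub>k\<close>.

  A row of a matrix annulling the rational points is an alternating form vanishing on isotropic
  tuples. The planes spanned by \<open>e\<^sub>a, e\<^bsub>b'\<^esub>\<close>, by \<open>e\<^sub>b, e\<^bsub>a'\<^esub>\<close> and by
  \<open>e\<^sub>a + e\<^sub>b, e\<^bsub>b'\<^esub> - e\<^bsub>a'\<^esub>\<close> are isotropic, and their Pluecker vectors combine to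
  \<open>e\<^sub>a \<and> e\<^bsub>a'\<^esub> - e\<^sub>b \<and> e\<^bsub>b'\<^esub>\<close>. Hence on each block the row is orthogonal to the products of such
  differences over perfect matchings of the free indices. If \<open>1, \<dots>, k - 1\<close> are invertible, the
  vectors orthogonal to all of these are exactly the row space of \<open>\<L>\<^sub>k\<close>. So every annulling matrix
  has the form \<open>P B\<close>, and maximal rank forces \<open>P\<close> to be invertible.\<close>

section \<open>Annihilators of matching vectors\<close>


text \<open>Each block \<open>L_mat (j + 1)\<close> lives on 2j points, where it is not square. With
  one point fewer there are as many (j-1)-sets as j-sets, no j disjoint pairs fit, and every
  function on j-sets must be a sum over its (j-1)-subsets, a shadow sum. That case is solved by an
  explicit inverse with denominators dividing j!; larger ground sets follow by adding points one at
  a time. Blocks satisfy 2j \<le> n, that is j \<le> r - 1, which explains the bound on the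
  characteristic. The field may be finite, so annulling forms cannot be studied through generic
  points or polynomial identities. Every isotropic tuple they are tested on therefore has
  coordinates 0, 1 and -1. The remaining obstacle is signs. With each basis index next to its
  partner, a hyperbolic pair is a segment of length two that moves through a tuple without changing
  sign. Values of a form can then be indexed by the set T of pairs alone, and the multilinear
  computation becomes one about functions on subsets.\<close>

fun matching_sum :: "('b set \<Rightarrow> 'a::comm_ring_1) \<Rightarrow> ('b \<times> 'b) list \<Rightarrow> 'b set \<Rightarrow> 'a" where
  "matching_sum h [] T = h T"
| "matching_sum h ((a, b) # M) T = matching_sum h M (insert a T) - matching_sum h M (insert b T)"

definition matching :: "('b \<times> 'b) list \<Rightarrow> bool" where
  "matching M \<longleftrightarrow> distinct (map fst M @ map snd M)"

definition support :: "('b \<times> 'b) list \<Rightarrow> 'b set" where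
  "support M = fst ` set M \<union> snd ` set M"

lemma matching_Nil [simp]: "matching []" "support [] = {}"
  by (simp_all add: matching_def support_def)

lemma matching_Cons [simp]:
  "matching ((a, b) # M) \<longleftrightarrow> matching M \<and> a \<noteq> b \<and> a \<notin> support M \<and> b \<notin> support M"
  "support ((a, b) # M) = insert a (insert b (support M))"
  by (auto simp: matching_def support_def)

lemma finite_support [simp]: "finite (support M)"
  by (simp add: support_def)

lemma card_support: "matching M \<Longrightarrow> card (support M) = 2 * length M"
proof (induction M)
  case (Cons p M)
  then show ?case by (cases p) auto
qed simp

lemma matching_sum_add:
  "matching_sum (\<lambda>T. f T + g T) M T = matching_sum f M T + matching_sum g M T"
  by (induction f M T rule: matching_sum.induct) auto

lemma matching_sum_diff:
  "matching_sum (\<lambda>T. f T - g T) M T = matching_sum f M T - matching_sum g M T"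
  by (induction f M T rule: matching_sum.induct) auto

text \<open>The recursion evaluates its function only at T joined with one endpoint of each pair.
  Identities known just for sets of one size inside the ground set can therefore be rewritten under
  the sum.\<close>

lemma matching_sum_cong:
  assumes "matching M" "finite T" "T \<inter> support M = {}"
    and "\<And>T'. T \<subseteq> T' \<Longrightarrow> T' \<subseteq> T \<union> support M \<Longrightarrow> card T' = card T + length M \<Longrightarrow> f T' = g T'"
  shows "matching_sum f M T = matching_sum g M T"
  using assms
proof (induction M arbitrary: T)
  case Nil
  then show ?case by simp
next
  case (Cons p M)
  obtain a b where p: "p = (a, b)" by (cases p)
  have "matching_sum f M (insert x T) = matching_sum g M (insert x T)" if x: "x \<in> {a, b}" for x
  proof (rule Cons.IH)
    have x': "x \<notin> T" using x p Cons.prems(3) by auto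
    show "insert x T \<inter> support M = {}" using x p Cons.prems(1,3) by auto
    fix T'
    assume T': "insert x T \<subseteq> T'" "T' \<subseteq> insert x T \<union> support M" "card T' = card (insert x T) + length M"
    show "f T' = g T'"
    proof (rule Cons.prems(4))
      show "T \<subseteq> T'" using T'(1) by blast
      show "T' \<subseteq> T \<union> support (p # M)" using T'(2) x p by auto
      show "card T' = card T + length (p # M)" using T'(3) x' Cons.prems(2) by simp
    qed
  qed (use Cons.prems p in auto)
  from this[of a] this[of b] show ?case by (simp add: p)
qed

text \<open>T accumulates the elements chosen so far, so a forced element may sit in T or inside the
  summed function.\<close>

lemma matching_sum_shift:
  "matching_sum (\<lambda>T. h (insert x T)) M T = matching_sum h M (insert x T)"
  by (induction M arbitrary: T) (auto simp: insert_commute)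

text \<open>The two choices from a pair contribute the same term with opposite signs once the chosen
  element has been removed again.\<close>

lemma matching_sum_removal:
  assumes "matching M" "finite T" "T \<inter> support M = {}"
  shows "matching_sum (\<lambda>S. \<Sum>t\<in>S. k (S - {t})) M T = matching_sum (\<lambda>S. \<Sum>t\<in>T. k (S - {t})) M T"
  using assms
proof (induction M arbitrary: T)
  case Nil
  then show ?case by simp
next
  case (Cons p M)
  obtain a b where p: "p = (a, b)" by (cases p)
  have step: "matching_sum (\<lambda>S. \<Sum>t\<in>S. k (S - {t})) M (insert x T)
      = matching_sum k M T + matching_sum (\<lambda>S. \<Sum>t\<in>T. k (S - {t})) M (insert x T)"
    if x: "x \<notin> T" "x \<notin> support M" for x
  proof -
    have "matching_sum (\<lambda>S. \<Sum>t\<in>S. k (S - {t})) M (insert x T)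
        = matching_sum (\<lambda>S. \<Sum>t\<in>insert x T. k (S - {t})) M (insert x T)"
      by (rule Cons.IH) (use Cons.prems x p in auto)
    also have "\<dots> = matching_sum (\<lambda>S. k (S - {x}) + (\<Sum>t\<in>T. k (S - {t}))) M (insert x T)"
      using x Cons.prems by simp
    also have "\<dots> = matching_sum (\<lambda>S. k (S - {x})) M (insert x T)
        + matching_sum (\<lambda>S. \<Sum>t\<in>T. k (S - {t})) M (insert x T)"
      by (rule matching_sum_add)
    also have "matching_sum (\<lambda>S. k (S - {x})) M (insert x T)
        = matching_sum (\<lambda>S. k (insert x S - {x})) M T"
      by (rule matching_sum_shift[symmetric])
    also have "\<dots> = matching_sum k M T"
      by (rule matching_sum_cong)
        (use Cons.prems x p in \<open>auto intro!: arg_cong[where f = k]\<close>)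
    finally show ?thesis .
  qed
  show ?case using step[of a] step[of b] Cons.prems p by simp
qed

text \<open>Deleting an element of T shrinks the intersection with T' only if the element lies in
  T'. For disjoint sets the truncated index \<open>0 - 1\<close> is harmless, since its factor is
  zero.\<close>

lemma sum_card_inter_remove:
  fixes c :: "nat \<Rightarrow> 'a::comm_ring_1"
  assumes "finite T"
  shows "(\<Sum>x\<in>T. c (card ((T - {x}) \<inter> T')))
    = of_nat (card (T \<inter> T')) * c (card (T \<inter> T') - 1) + of_nat (card (T - T')) * c (card (T \<inter> T'))"
proof -
  have "(\<Sum>x\<in>T. c (card ((T - {x}) \<inter> T')))
      = (\<Sum>x\<in>T \<inter> T'. c (card ((T - {x}) \<inter> T'))) + (\<Sum>x\<in>T - T'. c (card ((T - {x}) \<inter> T')))"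
    using assms by (subst sum.Int_Diff[of T _ T']) auto
  also have "(\<Sum>x\<in>T \<inter> T'. c (card ((T - {x}) \<inter> T'))) = (\<Sum>x\<in>T \<inter> T'. c (card (T \<inter> T') - 1))"
  proof (rule sum.cong)
    fix x assume x: "x \<in> T \<inter> T'"
    have "(T - {x}) \<inter> T' = (T \<inter> T') - {x}" by auto
    then show "c (card ((T - {x}) \<inter> T')) = c (card (T \<inter> T') - 1)" using x by simp
  qed simp
  also have "(\<Sum>x\<in>T - T'. c (card ((T - {x}) \<inter> T'))) = (\<Sum>x\<in>T - T'. c (card (T \<inter> T')))"
  proof (rule sum.cong)
    fix x assume x: "x \<in> T - T'"
    have "(T - {x}) \<inter> T' = T \<inter> T'" using x by auto
    then show "c (card ((T - {x}) \<inter> T')) = c (card (T \<inter> T'))" by simp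
  qed simp
  finally show ?thesis by simp
qed

text \<open>The coefficients \<open>c i\<close> solve \<open>i * c (i - 1) + (j - i) * c i = 0\<close> for \<open>0 < i < j\<close>, normalised by
  \<open>j * c (j - 1) = 1\<close>; two \<open>j\<close>-subsets of a set of size \<open>2 * j - 1\<close> always meet, so \<open>i = 0\<close>
  does not occur.\<close>

lemma shadow_sum_middle:
  fixes h :: "'b set \<Rightarrow> 'a::field"
  assumes "finite X" "card X + 1 = 2 * j" "(of_nat (fact j) :: 'a) \<noteq> 0"
  shows "\<exists>g. \<forall>T\<subseteq>X. card T = j \<longrightarrow> h T = (\<Sum>x\<in>T. g (T - {x}))"
proof -
  have j: "j > 0" using assms(2) by linarith
  define c :: "nat \<Rightarrow> 'a" where
    "c i = (- 1) ^ (j - 1 - i) / (of_nat j * of_nat ((j - 1) choose i))" for i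
  \<comment> \<open>The problem is symmetric under permutations of X, so an inverse of the shadow
    map is sought among kernels depending only on \<open>card (S \<inter> T')\<close>.\<close>
  define g where "g S = (\<Sum>T'\<in>{T'. T' \<subseteq> X \<and> card T' = j}. c (card (S \<inter> T')) * h T')" for S
  \<comment> \<open>Both factors in the denominators of \<open>c\<close> are nonzero because they
    divide factorials that divide \<open>fact j\<close>.\<close>
  have j0: "(of_nat j :: 'a) \<noteq> 0" "(of_nat (fact (j - 1)) :: 'a) \<noteq> 0"
    using assms(3) j fact_reduce[of j, where 'a = nat] by auto
  have ch: "(of_nat ((j - 1) choose i) :: 'a) \<noteq> 0" if "i < j" for i
  proof -
    have "fact i * fact (j - 1 - i) * ((j - 1) choose i) = (fact (j - 1) :: nat)"
      using that by (intro binomial_fact_lemma) auto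
    then show ?thesis using j0(2) by (metis mult_zero_right of_nat_mult)
  qed
  have last: "of_nat j * c (j - 1) = 1" using j0(1) by (simp add: c_def)
  have rec: "of_nat i * c (i - 1) + of_nat (j - i) * c i = 0" if i: "0 < i" "i < j" for i
  proof -
    obtain i' where i': "i = Suc i'" using i(1) by (cases i) auto
    obtain j' where j': "j = Suc j'" using j by (cases j) auto
    have "Suc i' * (j' choose Suc i') = (j' - i') * (j' choose i')"
      by (simp only: binomial_absorb_comp binomial_absorption)
    then have *: "(of_nat (Suc i') * of_nat (j' choose Suc i') :: 'a)
        = of_nat (j' - i') * of_nat (j' choose i')"
      by (metis of_nat_mult)
    have p: "(- 1 :: 'a) ^ (j' - i') = - ((- 1) ^ (j' - Suc i'))"
      using i i' j' by (metis Suc_diff_Suc less_Suc_eq_le less_eq_Suc_le mult_minus1 power_Suc)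
    have q: "(of_nat (Suc i') / of_nat (j' choose i') :: 'a) = of_nat (j' - i') / of_nat (j' choose Suc i')"
      using * ch[of i'] ch[of i] i i' j' by (simp add: divide_simps mult.commute del: of_nat_Suc)
    have split: "s * (t / (u * v)) = s / v * (t / u)" for s t u v :: 'a
      by (simp add: divide_inverse mult_ac)
    have "of_nat (Suc i') * c i' = of_nat (Suc i') / of_nat (j' choose i') * ((- 1) ^ (j' - i') / of_nat j)"
      unfolding c_def split by (simp only: j' diff_Suc_1)
    also have "\<dots> = - (of_nat (j' - i') / of_nat (j' choose Suc i') * ((- 1) ^ (j' - Suc i') / of_nat j))"
      unfolding q p by (simp only: minus_divide_left[symmetric] mult_minus_right)
    also have "\<dots> = - (of_nat (j' - i') * c (Suc i'))"
      unfolding c_def split by (simp only: j' diff_Suc_1)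
    finally have "of_nat (Suc i') * c i' + of_nat (j' - i') * c (Suc i') = 0" by (simp only: left_minus)
    moreover have "i - 1 = i'" "j - i = j' - i'" using i' j' by simp_all
    ultimately show ?thesis using i' by (simp only:)
  qed
  show ?thesis
  proof (intro exI[of _ g] allI impI)
    fix T assume T: "T \<subseteq> X" "card T = j"
    have fT: "finite T" using T(1) assms(1) finite_subset by blast
    have "(\<Sum>x\<in>T. g (T - {x}))
        = (\<Sum>T'\<in>{T'. T' \<subseteq> X \<and> card T' = j}. (\<Sum>x\<in>T. c (card ((T - {x}) \<inter> T'))) * h T')"
      unfolding g_def sum_distrib_right by (rule sum.swap)
    \<comment> \<open>The kernel sum is a Kronecker delta: \<open>last\<close> gives the diagonal,
      and for distinct T and T' the size of the intersection lies strictly between 0 and j, where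
      \<open>rec\<close> applies.\<close>
    also have "\<dots> = (\<Sum>T'\<in>{T'. T' \<subseteq> X \<and> card T' = j}. if T' = T then h T' else 0)"
    proof (rule sum.cong)
      fix T' assume "T' \<in> {T'. T' \<subseteq> X \<and> card T' = j}"
      then have T': "T' \<subseteq> X" "card T' = j" by auto
      have fT': "finite T'" using T'(1) assms(1) finite_subset by blast
      have sum: "card (T - T') + card (T \<inter> T') = j"
        using fT T(2) by (metis card_Diff_subset_Int add.commute card_Int_Diff)
      show "(\<Sum>x\<in>T. c (card ((T - {x}) \<inter> T'))) * h T' = (if T' = T then h T' else 0)"
      proof (cases "T' = T")
        case True
        then have "(\<Sum>x\<in>T. c (card ((T - {x}) \<inter> T'))) = of_nat j * c (j - 1)"
            using T(2) sum_card_inter_remove[OF fT, of c T'] by simp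
          then show ?thesis using last True by simp
      next
        case False
        have "card (T \<union> T') \<le> card X" using T T' assms(1) by (intro card_mono) auto
        then have "card (T \<inter> T') > 0"
          using card_Un_Int[OF fT fT'] T(2) T'(2) assms(2) by linarith
        moreover have "card (T \<inter> T') < j"
        proof -
          have "\<not> T \<subseteq> T'" using False T(2) T'(2) card_subset_eq[OF fT', of T] by auto
          then have "T \<inter> T' \<noteq> T" by blast
          then have "card (T \<inter> T') < card T" using fT by (intro psubset_card_mono) auto
          then show ?thesis using T(2) by simp
        qed
        moreover have "card (T - T') = j - card (T \<inter> T')" using sum by linarith
        ultimately have "(\<Sum>x\<in>T. c (card ((T - {x}) \<inter> T'))) = 0"
          using rec[of "card (T \<inter> T')"] by (simp only: sum_card_inter_remove[OF fT])
        then show ?thesis using False by simp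
      qed
    qed simp
    also have "\<dots> = h T" using T assms(1) by (subst sum.delta) auto
    finally show "h T = (\<Sum>x\<in>T. g (T - {x}))" by simp
  qed
qed

text \<open>The matching vectors span a Specht module of a two-row shape, and the lemma identifies
  its annihilator.\<close>

lemma shadow_sum_if_matching_sums_zero:
  fixes h :: "'b set \<Rightarrow> 'a::field"
  assumes "finite X" "2 * j \<le> card X + 1" "(of_nat (fact j) :: 'a) \<noteq> 0"
    and "\<And>M. matching M \<Longrightarrow> support M \<subseteq> X \<Longrightarrow> length M = j \<Longrightarrow> matching_sum h M {} = 0"
  shows "\<exists>g. \<forall>T\<subseteq>X. card T = j \<longrightarrow> h T = (\<Sum>x\<in>T. g (T - {x}))"
  using assms
proof (induction X arbitrary: j h)
  case empty
  then show ?case using "empty.prems"(3)[of "[]"] by simp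
next
  case (insert x X)
  show ?case
  proof (cases "j = 0")
    case True
    have "h {} = 0" using insert.prems(3)[of "[]"] True by simp
    moreover have "T = {}" if "T \<subseteq> insert x X" "card T = 0" for T
      using that insert.hyps(1) finite_subset[of T "insert x X"] by auto
    ultimately show ?thesis using True by (metis sum.empty)
  next
    case False
    show ?thesis
    proof (cases "card (insert x X) + 1 = 2 * j")
      case True
      \<comment> \<open>The square case, in which the hypothesis on matchings is vacuous.\<close>
      then show ?thesis using insert.hyps insert.prems by (intro shadow_sum_middle) auto
    next
      case small: False
      have X: "2 * j \<le> card X + 1" using small insert.prems(1) insert.hyps by simp
      have f: "(of_nat (fact (j - 1)) :: 'a) \<noteq> 0"
        using insert.prems(2) False fact_reduce[of j, where 'a = nat] by auto
      have "\<exists>g. \<forall>T\<subseteq>X. card T = j \<longrightarrow> h T = (\<Sum>x\<in>T. g (T - {x}))"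
        using insert.prems by (intro insert.IH X) auto
      then obtain g0 where g0: "\<And>T. T \<subseteq> X \<Longrightarrow> card T = j \<Longrightarrow> h T = (\<Sum>x\<in>T. g0 (T - {x}))"
        by blast
      \<comment> \<open>In the shadow sum of \<open>insert x T\<close> the removal of x contributes
        \<open>g0 T\<close>. The rest has to be a shadow sum over T, which is the same problem one
        degree lower.\<close>
      have "\<exists>g. \<forall>T\<subseteq>X. card T = j - 1 \<longrightarrow> h (insert x T) - g0 T = (\<Sum>x\<in>T. g (T - {x}))"
      proof (rule insert.IH)
        show "2 * (j - 1) \<le> card X + 1" using X by simp
        show "(of_nat (fact (j - 1)) :: 'a) \<noteq> 0" by (rule f)
        fix M assume M: "matching M" "support M \<subseteq> X" "length M = j - 1"
        \<comment> \<open>M covers 2j - 2 points while X has at least 2j - 1, so a partner y for x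
          is free and the hypothesis applies to M extended by the pair of x and y.\<close>
        have "card (support M) < card X" using M X card_support[OF M(1)] False by linarith
        then obtain y where y: "y \<in> X" "y \<notin> support M"
          using M(2) by (metis nat_neq_iff subset_antisym subsetI)
        have "x \<notin> support M" using M insert.hyps by auto
        have "0 = matching_sum h ((x, y) # M) {}"
          using M y insert.hyps False by (intro insert.prems(3)[symmetric]) auto
        also have "\<dots> = matching_sum (\<lambda>S. h (insert x S)) M {} - matching_sum (\<lambda>S. h (insert y S)) M {}"
          by (simp add: matching_sum_shift)
        also have "matching_sum (\<lambda>S. h (insert y S)) M {}
            = matching_sum (\<lambda>S. g0 S + (\<Sum>t\<in>S. g0 (insert y (S - {t})))) M {}"
        proof (rule matching_sum_cong)
          fix S assume "S \<subseteq> {} \<union> support M" "card S = card ({} :: 'b set) + length M"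
          then have S: "S \<subseteq> X" "card S = j - 1" "y \<notin> S" "finite S"
            using M y finite_subset[OF _ finite_support] by auto
          have "h (insert y S) = (\<Sum>t\<in>insert y S. g0 (insert y S - {t}))"
            using S y False by (intro g0) auto
          also have "\<dots> = g0 S + (\<Sum>t\<in>S. g0 (insert y S - {t}))" using S by simp
          also have "(\<Sum>t\<in>S. g0 (insert y S - {t})) = (\<Sum>t\<in>S. g0 (insert y (S - {t})))"
            using S(3) by (intro sum.cong) (auto intro!: arg_cong[where f = g0])
          finally show "h (insert y S) = g0 S + (\<Sum>t\<in>S. g0 (insert y (S - {t})))" .
        qed (use M in auto)
        \<comment> \<open>The shadow terms vanish by the removal lemma with empty accumulator. The
          difference rule for two zero functions supplies the fact that the matching sum of zero is
          zero.\<close>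
        also have "\<dots> = matching_sum g0 M {}"
          using matching_sum_removal[of M "{}" "\<lambda>S. g0 (insert y S)"] M
            matching_sum_diff[of "\<lambda>_. 0" "\<lambda>_. 0" M "{}"]
          by (simp add: matching_sum_add)
        finally show "matching_sum (\<lambda>T. h (insert x T) - g0 T) M {} = 0"
          by (simp add: matching_sum_diff)
      qed
      then obtain g1 where
        g1: "\<And>T. T \<subseteq> X \<Longrightarrow> card T = j - 1 \<Longrightarrow> h (insert x T) - g0 T = (\<Sum>x\<in>T. g1 (T - {x}))"
        by blast
      show ?thesis
      proof (intro exI[of _ "\<lambda>S. if x \<in> S then g1 (S - {x}) else g0 S"] allI impI)
        fix T assume T: "T \<subseteq> insert x X" "card T = j"
        have fT: "finite T" using T(1) insert.hyps(1) finite_subset by blast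
        show "h T = (\<Sum>t\<in>T. if x \<in> T - {t} then g1 (T - {t} - {x}) else g0 (T - {t}))"
        proof (cases "x \<in> T")
          case True
          define S where "S = T - {x}"
          have S: "T = insert x S" "x \<notin> S" "S \<subseteq> X" "card S = j - 1" "finite S"
            using T True fT unfolding S_def by auto
          have "(\<Sum>t\<in>T. if x \<in> T - {t} then g1 (T - {t} - {x}) else g0 (T - {t}))
              = g0 S + (\<Sum>t\<in>S. if x \<in> T - {t} then g1 (T - {t} - {x}) else g0 (T - {t}))"
            using S by simp
          also have "(\<Sum>t\<in>S. if x \<in> T - {t} then g1 (T - {t} - {x}) else g0 (T - {t}))
              = (\<Sum>t\<in>S. g1 (S - {t}))"
            using S(1,2) by (intro sum.cong) (auto intro!: arg_cong[where f = g1])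
          finally show ?thesis using g1[OF S(3,4)] S(1) by (simp add: algebra_simps)
        next
          case False
          then show ?thesis using g0[of T] T by auto
        qed
      qed
    qed
  qed
qed

section \<open>Index lists up to moving adjacent pairs\<close>


text \<open>Covers two situations at once: an alternating form as a function of its vectors, and a
  determinant as a function of its list of columns. Only lists of length k are constrained, because
  alternating forms are arbitrary at other lengths.\<close>

definition skew :: "nat \<Rightarrow> ('b list \<Rightarrow> 'a::ab_group_add) \<Rightarrow> bool" where
  "skew k f \<longleftrightarrow> (\<forall>xs a b ys. length xs + length ys + 2 = k \<longrightarrow> f (xs @ a # b # ys) = - f (xs @ b # a # ys))"

lemma skewD: "skew k f \<Longrightarrow> length xs + length ys + 2 = k \<Longrightarrow> f (xs @ a # b # ys) = - f (xs @ b # a # ys)"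
  unfolding skew_def by blast

lemma skew_Cons:
  fixes f :: "'b list \<Rightarrow> 'a::ab_group_add"
  assumes "skew (Suc k) f"
  shows "skew k (\<lambda>L. f (x # L))"
  unfolding skew_def
proof (intro allI impI)
  fix xs ys :: "'b list" and a b :: 'b
  assume "length xs + length ys + 2 = k"
  then show "f (x # xs @ a # b # ys) = - f (x # xs @ b # a # ys)"
    using skewD[OF assms, of "x # xs" ys a b] by auto
qed

lemma skew_map:
  fixes f :: "'b list \<Rightarrow> 'a::ab_group_add" and e :: "'c \<Rightarrow> 'b"
  assumes "skew k f"
  shows "skew k (\<lambda>L. f (map e L))"
  unfolding skew_def
proof (intro allI impI)
  fix xs ys :: "'c list" and a b :: 'c
  assume "length xs + length ys + 2 = k"
  then show "f (map e (xs @ a # b # ys)) = - f (map e (xs @ b # a # ys))"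
    using skewD[OF assms, of "map e xs" "map e ys" "e a" "e b"] by auto
qed

text \<open>Passing one entry takes two adjacent transpositions, whose signs cancel.\<close>

lemma skew_move_pair:
  assumes "skew k f" "length xs + length ys + 2 = k"
  shows "f (xs @ a # b # ys) = f (a # b # xs @ ys)"
  using assms(2)
proof (induction xs arbitrary: ys rule: rev_induct)
  case (snoc x xs)
  have "f (xs @ x # a # b # ys) = - f (xs @ a # x # b # ys)"
    using snoc.prems by (intro skewD[OF assms(1)]) simp
  also have "f (xs @ a # x # b # ys) = - f (xs @ a # b # x # ys)"
    using skewD[OF assms(1), of "xs @ [a]" ys x b] snoc.prems by simp
  also have "f (xs @ a # b # x # ys) = f (a # b # xs @ x # ys)"
    using snoc.prems by (intro snoc.IH) simp
  finally show ?case by simp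
qed simp

definition pairs :: "nat \<Rightarrow> nat set \<Rightarrow> nat set" where
  "pairs n T = T \<union> (\<lambda>i. 2 * n - i + 1) ` T"

text \<open>The order of factors in \<open>basis_wedge\<close>: the basis vector for \<beta> is the
  wedge of \<open>map e (ordered n \<beta>)\<close>.\<close>

definition ordered :: "nat \<Rightarrow> nat set \<Rightarrow> nat list" where
  "ordered n \<beta> = filter (\<lambda>j. j \<in> \<beta>) (pair_order n)"

definition pair_list :: "nat \<Rightarrow> nat list \<Rightarrow> nat list" where
  "pair_list n L = concat (map (\<lambda>i. [i, 2 * n - i + 1]) L)"

lemma pair_list_simps [simp]:
  "pair_list n [] = []" "pair_list n (i # L) = i # (2 * n - i + 1) # pair_list n L"
  by (simp_all add: pair_list_def)

lemma length_pair_list [simp]: "length (pair_list n L) = 2 * length L"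
  by (induction L) auto

lemma set_pair_list [simp]: "set (pair_list n L) = pairs n (set L)"
  by (induction L) (auto simp: pairs_def)

lemma pairs_simps [simp]:
  "pairs n {} = {}" "pairs n (insert i T) = insert i (insert (2 * n - i + 1) (pairs n T))"
  by (auto simp: pairs_def)

text \<open>Elements of T are at most n and their partners exceed n, so an index cannot be mistaken
  for a partner.\<close>

lemma mem_pairs_iff:
  assumes "T \<subseteq> {1..n}" "i \<in> {1..n}"
  shows "i \<in> pairs n T \<longleftrightarrow> i \<in> T" "Suc (2 * n - i) \<in> pairs n T \<longleftrightarrow> i \<in> T"
proof -
  have *: "i \<noteq> 2 * n - j + 1" "Suc (2 * n - i) \<noteq> j" "Suc (2 * n - i) = 2 * n - j + 1 \<longleftrightarrow> i = j"
    if "j \<in> T" for j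
  proof -
    have "j \<in> {1..n}" using that assms(1) by blast
    then show "i \<noteq> 2 * n - j + 1" "Suc (2 * n - i) \<noteq> j" "Suc (2 * n - i) = 2 * n - j + 1 \<longleftrightarrow> i = j"
      using assms(2) by auto
  qed
  show "i \<in> pairs n T \<longleftrightarrow> i \<in> T" using *(1) by (auto simp: pairs_def)
  show "Suc (2 * n - i) \<in> pairs n T \<longleftrightarrow> i \<in> T" using *(2,3) unfolding pairs_def by blast
qed

lemma pair_order_conv: "pair_order n = pair_list n [1..<n + 1]"
  by (simp add: pair_order_def pair_list_def)

lemma distinct_pair_list:
  "distinct L \<Longrightarrow> set L \<subseteq> {1..n} \<Longrightarrow> distinct (pair_list n L)"
  by (induction L) (auto simp: mem_pairs_iff)

lemma distinct_ordered: "distinct (ordered n \<beta>)"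
  unfolding ordered_def pair_order_conv by (intro distinct_filter distinct_pair_list) auto

lemma pairs_all: "pairs n {1..n} = {1..2 * n}"
proof -
  have "j \<in> (\<lambda>i. 2 * n - i + 1) ` {1..n}" if "j \<in> {1..2 * n}" "j \<notin> {1..n}" for j
    using that by (intro image_eqI[of _ _ "2 * n - j + 1"]) auto
  then have "{1..2 * n} \<subseteq> pairs n {1..n}" unfolding pairs_def by blast
  moreover have "pairs n {1..n} \<subseteq> {1..2 * n}" by (auto simp: pairs_def)
  ultimately show ?thesis by (rule equalityI[rotated])
qed

lemma set_ordered: "\<beta> \<subseteq> {1..2 * n} \<Longrightarrow> set (ordered n \<beta>) = \<beta>"
  using pairs_all[of n] by (auto simp: ordered_def pair_order_conv atLeastLessThanSuc_atLeastAtMost simp del: upt_Suc)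

lemma length_ordered: "\<beta> \<subseteq> {1..2 * n} \<Longrightarrow> length (ordered n \<beta>) = card \<beta>"
  by (metis distinct_card distinct_ordered set_ordered)

text \<open>Partners are neighbours in \<open>pair_order\<close>, so adding a complete pair inserts
  one contiguous segment.\<close>

lemma pair_split:
  assumes "i \<in> {1..n}" "i \<notin> \<gamma>" "2 * n - i + 1 \<notin> \<gamma>"
  obtains A C where "ordered n (insert i (insert (2 * n - i + 1) \<gamma>)) = A @ i # (2 * n - i + 1) # C"
    "ordered n \<gamma> = A @ C"
proof -
  define i' where "i' = 2 * n - i + 1"
  have po: "pair_order n = pair_list n [1..<i] @ i # i' # pair_list n [i + 1..<n + 1]"
  proof -
    have "[1..<n + 1] = [1..<i] @ [i..<n + 1]"
      using assms(1) upt_add_eq_append[of 1 i "n + 1 - i"] by (simp del: upt_Suc)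
    also have "[i..<n + 1] = i # [i + 1..<n + 1]"
      using assms(1) by (subst upt_conv_Cons) auto
    finally have "[1..<n + 1] = [1..<i] @ i # [i + 1..<n + 1]" .
    then show ?thesis unfolding pair_order_conv i'_def by (simp add: pair_list_def del: upt_Suc)
  qed
  have "distinct (pair_order n)" unfolding pair_order_conv by (intro distinct_pair_list) auto
  then have d: "i \<notin> set (pair_list n [1..<i])" "i' \<notin> set (pair_list n [1..<i])"
    "i \<notin> set (pair_list n [i + 1..<n + 1])" "i' \<notin> set (pair_list n [i + 1..<n + 1])" "i \<noteq> i'"
    unfolding po by (auto simp del: upt_Suc set_pair_list)
  have f: "filter (\<lambda>j. j \<in> insert i (insert i' \<gamma>)) L = filter (\<lambda>j. j \<in> \<gamma>) L"
    if "i \<notin> set L" "i' \<notin> set L" for L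
    using that by (intro filter_cong) auto
  show ?thesis
  proof (rule that)
    show "ordered n (insert i (insert (2 * n - i + 1) \<gamma>)) = filter (\<lambda>j. j \<in> \<gamma>) (pair_list n [1..<i])
        @ i # (2 * n - i + 1) # filter (\<lambda>j. j \<in> \<gamma>) (pair_list n [i + 1..<n + 1])"
      unfolding ordered_def po i'_def[symmetric] filter_append filter.simps f[OF d(1,2)] f[OF d(3,4)]
      by simp
    show "ordered n \<gamma> = filter (\<lambda>j. j \<in> \<gamma>) (pair_list n [1..<i])
        @ filter (\<lambda>j. j \<in> \<gamma>) (pair_list n [i + 1..<n + 1])"
      unfolding ordered_def po filter_append filter.simps
      using assms i'_def by simp
  qed
qed

text \<open>Complete pairs move to the front without a sign, hence also in any order L. This makes
  the value at an index set depend on S and the set of pairs, with no permutation sign to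
  track.\<close>

lemma skew_ordered:
  assumes "skew k f" "distinct L" "set L \<subseteq> {1..n}" "S \<inter> pairs n (set L) = {}" "S \<subseteq> {1..2 * n}"
    and "card S + 2 * length L = k"
  shows "f (ordered n (S \<union> pairs n (set L))) = f (pair_list n L @ ordered n S)"
  using assms
proof (induction L arbitrary: k f)
  case (Cons i L)
  define \<gamma> where "\<gamma> = S \<union> pairs n (set L)"
  have i: "i \<in> {1..n}" "i \<notin> \<gamma>" "2 * n - i + 1 \<notin> \<gamma>"
    using Cons.prems by (auto simp: \<gamma>_def mem_pairs_iff)
  obtain A C where AC: "ordered n (insert i (insert (2 * n - i + 1) \<gamma>)) = A @ i # (2 * n - i + 1) # C"
    "ordered n \<gamma> = A @ C" using pair_split[OF i] by blast
  have LL: "set L \<subseteq> {1..n}" using Cons.prems by simp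
  have "pairs n (set L) \<subseteq> {1..2 * n}" using LL pairs_all[of n] by (auto simp: pairs_def)
  then have \<gamma>: "\<gamma> \<subseteq> {1..2 * n}" using Cons.prems by (auto simp: \<gamma>_def)
  have "card (pairs n (set L)) = 2 * length L"
    using distinct_card[OF distinct_pair_list[OF _ LL]] Cons.prems by simp
  then have "card \<gamma> = card S + 2 * length L" unfolding \<gamma>_def
    using Cons.prems finite_subset[OF Cons.prems(5)] finite_subset[OF \<open>pairs n (set L) \<subseteq> _\<close>]
    by (subst card_Un_disjoint) auto
  then have len: "length A + length C + 2 = k"
    using length_ordered[OF \<gamma>] AC(2) Cons.prems(6) by simp
  have "f (ordered n (S \<union> pairs n (set (i # L)))) = f (A @ i # (2 * n - i + 1) # C)"
    using AC(1) by (simp add: \<gamma>_def)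
  also have "\<dots> = f (i # (2 * n - i + 1) # A @ C)"
    by (rule skew_move_pair[OF Cons.prems(1) len])
  also have "\<dots> = f (i # (2 * n - i + 1) # ordered n \<gamma>)" using AC(2) by simp
  \<comment> \<open>The two leading entries stay fixed; as a function of the rest of the list, f is
    skew in length k - 2.\<close>
  also have "\<dots> = f (i # (2 * n - i + 1) # pair_list n L @ ordered n S)"
    unfolding \<gamma>_def
  proof (rule Cons.IH[where f = "\<lambda>M. f (i # (2 * n - i + 1) # M)"])
    show "skew (k - 2) (\<lambda>M. f (i # (2 * n - i + 1) # M))"
      using Cons.prems(1,6) by (intro skew_Cons[of "k - 2" "\<lambda>M. f (i # M)"] skew_Cons[of _ f]) (auto simp: Suc_diff_Suc numeral_2_eq_2)
  qed (use Cons.prems in auto)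
  finally show ?case by simp
qed simp

section \<open>Alternating forms and minors\<close>


lemma skew_zero_move:
  assumes "skew k f" "length us + length vs + 1 = k" "f (us @ x # vs) = 0"
  shows "f (x # us @ vs) = 0"
  using assms(2,3)
proof (induction us arbitrary: vs rule: rev_induct)
  case (snoc u us)
  have "f (us @ x # u # vs) = - f (us @ u # x # vs)"
    using snoc.prems(1) by (intro skewD[OF assms(1)]) simp
  also have "f (us @ u # x # vs) = 0" using snoc.prems(2) by simp
  finally have "f (x # us @ u # vs) = 0"
    using snoc.prems(1) by (intro snoc.IH) auto
  then show ?case by simp
qed simp

text \<open>Reordering changes a skew function only by a sign, and vanishing ignores signs, so no
  sign of a permutation has to be computed.\<close>

lemma skew_zero_mset:
  assumes "skew k f" "length ys = k" "mset xs = mset ys" "f ys = 0"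
  shows "f xs = 0"
  using assms
proof (induction xs arbitrary: ys k f)
  case (Cons x xs)
  have "x \<in> set ys" using Cons.prems(3) by (metis list.set_intros(1) set_mset_mset)
  then obtain us vs where ys: "ys = us @ x # vs" by (meson split_list)
  have "f (x # us @ vs) = 0"
    using Cons.prems ys by (intro skew_zero_move[OF Cons.prems(1)]) auto
  moreover have "skew (length (us @ vs)) (\<lambda>L. f (x # L))"
    using Cons.prems ys by (intro skew_Cons) auto
  ultimately show ?case
    using Cons.prems(3) ys by (intro Cons.IH[of _ "\<lambda>L. f (x # L)" "us @ vs"]) auto
qed simp

lemma det_row_expansion:
  fixes F :: "'b \<Rightarrow> nat \<Rightarrow> 'a::comm_ring_1"
  assumes "length xs + length ys + 1 = m"
  obtains C where "\<And>x. det (mat m m (\<lambda>(p, q). F ((xs @ x # ys) ! p) q)) = (\<Sum>q<m. F x q * C q)"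
proof -
  define A where "A x = mat m m (\<lambda>(p, q). F ((xs @ x # ys) ! p) q)" for x
  \<comment> \<open>Deleting the row removes everything that depends on x; \<open>undefined\<close>
    names an arbitrary representative of the common cofactor.\<close>
  have cof: "cofactor (A x) (length xs) q = cofactor (A undefined) (length xs) q" if "q < m" for x q
  proof -
    have "mat_delete (A x) (length xs) q = mat_delete (A undefined) (length xs) q"
      using assms that by (intro eq_matI) (auto simp: mat_delete_def A_def nth_append)
    then show ?thesis by (simp add: cofactor_def)
  qed
  have "det (A x) = (\<Sum>q<m. F x q * cofactor (A undefined) (length xs) q)" for x
  proof -
    have "det (A x) = (\<Sum>q<m. A x $$ (length xs, q) * cofactor (A x) (length xs) q)"
      using assms by (intro laplace_expansion_row) (auto simp: A_def)
    also have "\<dots> = (\<Sum>q<m. F x q * cofactor (A undefined) (length xs) q)"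
    proof (rule sum.cong)
      fix q assume "q \<in> {..<m}"
      moreover from this have "A x $$ (length xs, q) = F x q"
        using assms by (simp add: A_def)
      ultimately show "A x $$ (length xs, q) * cofactor (A x) (length xs) q
          = F x q * cofactor (A undefined) (length xs) q"
        using cof[of q x] by simp
    qed simp
    finally show ?thesis .
  qed
  then show ?thesis using that unfolding A_def by blast
qed

lemma skew_det:
  "skew m (\<lambda>L. det (mat m m (\<lambda>(p, q). F p (L ! q))) :: 'a::comm_ring_1)"
  unfolding skew_def
proof (intro allI impI)
  fix xs ys :: "'b list" and a b assume len: "length xs + length ys + 2 = m"
  define A where "A L = mat m m (\<lambda>(p, q). F p (L ! q))" for L
  have "A (xs @ a # b # ys) = swapcols (length xs) (Suc (length xs)) (A (xs @ b # a # ys))"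
    using len by (intro eq_matI) (auto simp: A_def nth_append nth_Cons split: nat.splits)
  moreover have "det (swapcols (length xs) (Suc (length xs)) (A (xs @ b # a # ys))) = - det (A (xs @ b # a # ys))"
    using len by (intro det_swapcols[where n = m]) (auto simp: A_def)
  ultimately show "det (mat m m (\<lambda>(p, q). F p ((xs @ a # b # ys) ! q)))
      = - det (mat m m (\<lambda>(p, q). F p ((xs @ b # a # ys) ! q)))"
    by (simp add: A_def)
qed

lemma index_set_length: "\<beta> \<in> index_set k (2 * n) \<Longrightarrow> length (ordered n \<beta>) = k"
  by (simp add: index_set_def length_ordered)

lemma finite_index_set [simp]: "finite (index_set k m)"
  by (rule finite_subset[of _ "Pow {1..m}"]) (auto simp: index_set_def)

section \<open>Alternating forms on an arbitrary vector space\<close>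

context vector_space
begin

lemma linear_functional_iff:
  "Vector_Spaces.linear scale (*) f \<longleftrightarrow> (\<forall>x y. f (x + y) = f x + f y) \<and> (\<forall>c x. f (scale c x) = c * f x)"
proof -
  have "vector_space ((*) :: 'a \<Rightarrow> 'a \<Rightarrow> 'a)"
    by unfold_locales (auto simp: algebra_simps)
  then show ?thesis
    unfolding Vector_Spaces.linear_iff using vector_space_axioms by blast
qed

lemma alternating_formI:
  assumes "\<And>xs x y ys. length xs + length ys + 1 = k \<Longrightarrow> \<phi> (xs @ (x + y) # ys) = \<phi> (xs @ x # ys) + \<phi> (xs @ y # ys)"
    and "\<And>xs c x ys. length xs + length ys + 1 = k \<Longrightarrow> \<phi> (xs @ scale c x # ys) = c * \<phi> (xs @ x # ys)"
    and "\<And>xs x ys zs. length xs + length ys + length zs + 2 = k \<Longrightarrow> \<phi> (xs @ x # ys @ x # zs) = 0"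
  shows "alternating_form scale k \<phi>"
  unfolding alternating_form_def linear_functional_iff
proof (intro conjI allI impI)
  fix v :: "'b list" and i assume v: "length v = k" "i < k"
  have upd: "v[i := x] = take i v @ x # drop (Suc i) v" for x
    using v by (simp add: upd_conv_take_nth_drop)
  show "\<phi> (v[i := x + y]) = \<phi> (v[i := x]) + \<phi> (v[i := y])" for x y
    unfolding upd using v by (intro assms(1)) auto
  show "\<phi> (v[i := scale c x]) = c * \<phi> (v[i := x])" for c x
    unfolding upd using v by (intro assms(2)) auto
next
  fix v :: "'b list" and i j assume v: "length v = k" "i < j" "j < k" "v ! i = v ! j"
  define u where "u = drop (Suc i) v"
  have "v = take i v @ v ! i # u"
    unfolding u_def using v by (intro id_take_nth_drop) auto
  moreover have "u = take (j - Suc i) u @ u ! (j - Suc i) # drop (Suc (j - Suc i)) u"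
    unfolding u_def using v by (intro id_take_nth_drop) auto
  moreover have "u ! (j - Suc i) = v ! i"
    using v by (simp add: u_def)
  ultimately have "v = take i v @ v ! i # take (j - Suc i) u @ v ! i # drop (Suc (j - Suc i)) u"
    by simp
  moreover have "\<phi> (take i v @ v ! i # take (j - Suc i) u @ v ! i # drop (Suc (j - Suc i)) u) = 0"
    using v by (intro assms(3)) (auto simp: u_def)
  ultimately show "\<phi> v = 0" by simp
qed

lemma
  assumes "alternating_form scale k \<phi>"
  shows alternating_form_add: "length xs + length ys + 1 = k \<Longrightarrow>
      \<phi> (xs @ (x + y) # ys) = \<phi> (xs @ x # ys) + \<phi> (xs @ y # ys)"
    and alternating_form_scale: "length xs + length ys + 1 = k \<Longrightarrow>
      \<phi> (xs @ scale c x # ys) = c * \<phi> (xs @ x # ys)"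
    and alternating_form_repeat: "length xs + length ys + length zs + 2 = k \<Longrightarrow>
      \<phi> (xs @ x # ys @ x # zs) = 0"
proof -
  have lin: "Vector_Spaces.linear scale (*) (\<lambda>x. \<phi> (v[i := x]))" if "length v = k" "i < k" for v i
    using assms that by (simp add: alternating_form_def)
  {
    assume len: "length xs + length ys + 1 = k"
    have upd: "(xs @ 0 # ys)[length xs := z] = xs @ z # ys" for z by simp
    have "Vector_Spaces.linear scale (*) (\<lambda>z. \<phi> (xs @ z # ys))"
      using lin[of "xs @ 0 # ys" "length xs"] len unfolding upd by simp
    then show "\<phi> (xs @ (x + y) # ys) = \<phi> (xs @ x # ys) + \<phi> (xs @ y # ys)"
      "\<phi> (xs @ scale c x # ys) = c * \<phi> (xs @ x # ys)"
      unfolding linear_functional_iff by blast+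
  }
  assume len: "length xs + length ys + length zs + 2 = k"
  have "(xs @ x # ys @ x # zs) ! length xs = (xs @ x # ys @ x # zs) ! (length xs + length ys + 1)"
    by (simp add: nth_append)
  then show "\<phi> (xs @ x # ys @ x # zs) = 0"
    using assms len unfolding alternating_form_def
    by (elim conjE allE[where x = "xs @ x # ys @ x # zs"] allE[where x = "length xs"]
        allE[where x = "length xs + length ys + 1"]) auto
qed

lemma alternating_form_skew:
  assumes "alternating_form scale k \<phi>"
  shows "skew k \<phi>"
  unfolding skew_def
proof (intro allI impI)
  fix xs ys :: "'b list" and a b assume len: "length xs + length ys + 2 = k"
  have add: "\<phi> (xs @ (x + y) # z # ys) = \<phi> (xs @ x # z # ys) + \<phi> (xs @ y # z # ys)"
    "\<phi> (xs @ z # (x + y) # ys) = \<phi> (xs @ z # x # ys) + \<phi> (xs @ z # y # ys)" for x y z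
    using alternating_form_add[OF assms, of xs "z # ys" x y]
      alternating_form_add[OF assms, of "xs @ [z]" ys x y] len by simp_all
  have rep: "\<phi> (xs @ x # x # ys) = 0" for x
    using alternating_form_repeat[OF assms, of xs "[]" ys x] len by simp
  have "0 = \<phi> (xs @ (a + b) # (a + b) # ys)" by (rule rep[symmetric])
  also have "\<dots> = \<phi> (xs @ a # b # ys) + \<phi> (xs @ b # a # ys)"
    unfolding add unfolding rep by simp
  finally show "\<phi> (xs @ a # b # ys) = - \<phi> (xs @ b # a # ys)"
    by (metis eq_neg_iff_add_eq_0)
qed

lemma alternating_form_zero:
  "alternating_form scale k \<phi> \<Longrightarrow> length xs + length ys + 1 = k \<Longrightarrow> \<phi> (xs @ 0 # ys) = 0"
  using alternating_form_scale[of k \<phi> xs ys 0 0] by simp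

lemma alternating_form_sum_entry:
  assumes "alternating_form scale k \<phi>" "length xs + length ys + 1 = k"
  shows "\<phi> (xs @ (\<Sum>j\<in>J. scale (c j) (u j)) # ys) = (\<Sum>j\<in>J. c j * \<phi> (xs @ u j # ys))"
  by (induction J rule: infinite_finite_induct)
    (simp_all add: alternating_form_zero[OF assms] alternating_form_add[OF assms] alternating_form_scale[OF assms])

lemma alternating_form_not_distinct:
  assumes "alternating_form scale k \<phi>" "length v = k" "\<not> distinct v"
  shows "\<phi> v = 0"
proof -
  obtain xs x ys zs where "v = xs @ [x] @ ys @ [x] @ zs" using not_distinct_decomp[OF assms(3)] by blast
  then show ?thesis using alternating_form_repeat[OF assms(1), of xs ys zs x] assms(2) by simp
qed

text \<open>Rational points come from independent tuples only. This lemma extends the vanishing of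
  an annulling form from them to all isotropic tuples, as multilinear computations require.\<close>

lemma alternating_form_dependent:
  assumes "alternating_form scale k \<phi>" "length v = k" "dependent (set v)"
  shows "\<phi> v = 0"
proof (cases "distinct v")
  case True
  obtain x where x: "x \<in> set v" "x \<in> span (set v - {x})" using assms(3) unfolding dependent_def by blast
  obtain xs ys where v: "v = xs @ x # ys" using x(1) by (meson split_list)
  obtain c where c: "x = (\<Sum>y\<in>set v - {x}. scale (c y) y)"
    using x(2) span_finite[of "set v - {x}"] by auto
  have len: "length xs + length ys + 1 = k" using v assms(2) by simp
  have "\<phi> v = (\<Sum>y\<in>set v - {x}. c y * \<phi> (xs @ y # ys))"
    using alternating_form_sum_entry[OF assms(1) len, of c "\<lambda>y. y" "set v - {x}"]
    unfolding c[symmetric] v[symmetric] .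
  also have "\<dots> = 0"
  proof (intro sum.neutral ballI)
    fix y assume "y \<in> set v - {x}"
    then have "\<not> distinct (xs @ y # ys)" using v by auto
    then have "\<phi> (xs @ y # ys) = 0"
      using alternating_form_not_distinct[OF assms(1), of "xs @ y # ys"] len by simp
    then show "c y * \<phi> (xs @ y # ys) = 0" by simp
  qed
  finally show ?thesis .
qed (use alternating_form_not_distinct[OF assms(1,2)] in blast)

lemma alternating_form_diff:
  assumes "alternating_form scale k \<phi>" "alternating_form scale k \<psi>"
  shows "alternating_form scale k (\<lambda>v. \<phi> v - \<psi> v)"
  by (rule alternating_formI)
    (simp_all add: assms[THEN alternating_form_add] assms[THEN alternating_form_scale]
      assms[THEN alternating_form_repeat] algebra_simps)

lemma alternating_form_lincomb:
  assumes "\<And>\<beta>. \<beta> \<in> I \<Longrightarrow> alternating_form scale k (\<phi> \<beta>)"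
  shows "alternating_form scale k (\<lambda>v. \<Sum>\<beta>\<in>I. c \<beta> * \<phi> \<beta> v)"
proof (rule alternating_formI)
  fix xs ys :: "'b list" and x y assume "length xs + length ys + 1 = k"
  then show "(\<Sum>\<beta>\<in>I. c \<beta> * \<phi> \<beta> (xs @ (x + y) # ys))
      = (\<Sum>\<beta>\<in>I. c \<beta> * \<phi> \<beta> (xs @ x # ys)) + (\<Sum>\<beta>\<in>I. c \<beta> * \<phi> \<beta> (xs @ y # ys))"
    by (simp add: assms[THEN alternating_form_add] sum.distrib distrib_left)
next
  fix xs ys :: "'b list" and x d assume "length xs + length ys + 1 = k"
  then show "(\<Sum>\<beta>\<in>I. c \<beta> * \<phi> \<beta> (xs @ scale d x # ys)) = d * (\<Sum>\<beta>\<in>I. c \<beta> * \<phi> \<beta> (xs @ x # ys))"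
    by (simp add: assms[THEN alternating_form_scale] sum_distrib_left mult.left_commute)
next
  fix xs ys zs :: "'b list" and x assume "length xs + length ys + length zs + 2 = k"
  then show "(\<Sum>\<beta>\<in>I. c \<beta> * \<phi> \<beta> (xs @ x # ys @ x # zs)) = 0"
    by (simp add: assms[THEN alternating_form_repeat])
qed

end

section \<open>Coordinate functionals, minors and Pluecker coordinates\<close>

context symplectic_space
begin

definition coord :: "nat \<Rightarrow> 'e \<Rightarrow> 'a" where
  "coord j x = representation (e ` {1..2 * n}) x (e j)"

lemma coord_add: "coord j (x + y) = coord j x + coord j y"
  and coord_scale: "coord j (scale c x) = c * coord j x"
  using basis_independent basis_span
  by (simp_all add: coord_def representation_add representation_scale)

lemma coord_basis:
  "i \<in> {1..2 * n} \<Longrightarrow> j \<in> {1..2 * n} \<Longrightarrow> coord j (e i) = (if i = j then 1 else 0)"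
  using representation_basis[OF basis_independent, of "e i"] inj_on_eq_iff[OF basis_inj, of j i]
  by (simp add: coord_def)

lemma coord_expansion: "x = (\<Sum>j = 1..2 * n. scale (coord j x) (e j))"
proof -
  have "x = (\<Sum>b\<in>e ` {1..2 * n}. scale (representation (e ` {1..2 * n}) x b) b)"
    using basis_independent basis_span by (intro sum_representation_eq[symmetric]) auto
  also have "\<dots> = (\<Sum>j = 1..2 * n. scale (coord j x) (e j))"
    using basis_inj by (simp add: sum.reindex coord_def)
  finally show ?thesis .
qed

definition minor :: "nat list \<Rightarrow> 'e list \<Rightarrow> 'a" where
  "minor L v = det (mat n n (\<lambda>(p, q). coord (L ! q) (v ! p)))"

lemma alternating_form_minor: "alternating_form scale n (minor L)"
proof (rule alternating_formI)
  fix xs ys :: "'e list" and x y c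
  assume len: "length xs + length ys + 1 = n"
  obtain C where "\<And>x. minor L (xs @ x # ys) = (\<Sum>q<n. coord (L ! q) x * C q)"
    using det_row_expansion[OF len, of "\<lambda>x q. coord (L ! q) x"] unfolding minor_def by blast
  then show "minor L (xs @ (x + y) # ys) = minor L (xs @ x # ys) + minor L (xs @ y # ys)"
    "minor L (xs @ scale c x # ys) = c * minor L (xs @ x # ys)"
    by (simp_all add: coord_add coord_scale sum.distrib distrib_right sum_distrib_left mult.assoc)
next
  fix xs ys zs :: "'e list" and x
  assume len: "length xs + length ys + length zs + 2 = n"
  have v: "(xs @ x # ys @ x # zs) ! length xs = x" "(xs @ x # ys @ x # zs) ! (length xs + length ys + 1) = x"
    by (simp_all add: nth_append)
  show "minor L (xs @ x # ys @ x # zs) = 0"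
    unfolding minor_def
    by (rule det_identical_rows[of _ n "length xs" "length xs + length ys + 1"])
      (use len v in \<open>auto intro!: eq_vecI\<close>)
qed

lemma skew_minor: "skew n (\<lambda>L. minor L v)"
  unfolding minor_def by (rule skew_det)

lemma minor_repeat:
  assumes "length L = n" "\<not> distinct L"
  shows "minor L v = 0"
proof -
  obtain i j where "i < n" "j < n" "i \<noteq> j" "L ! i = L ! j"
    using assms by (auto simp: distinct_conv_nth)
  then show ?thesis unfolding minor_def
    by (intro det_identical_columns[of _ n i j]) (auto intro!: eq_vecI)
qed

lemma minor_basis:
  assumes "\<alpha> \<in> index_set n (2 * n)" "\<beta> \<in> index_set n (2 * n)"
  shows "minor (ordered n \<beta>) (map e (ordered n \<alpha>)) = (if \<alpha> = \<beta> then 1 else 0)"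
proof -
  have len: "length (ordered n \<alpha>) = n" "length (ordered n \<beta>) = n"
    using assms index_set_length by auto
  have \<alpha>: "\<alpha> \<subseteq> {1..2 * n}" "\<beta> \<subseteq> {1..2 * n}" "card \<alpha> = n" "card \<beta> = n"
    using assms by (auto simp: index_set_def)
  have mem: "ordered n \<alpha> ! i \<in> {1..2 * n}" "ordered n \<beta> ! i \<in> {1..2 * n}" if "i < n" for i
    using that len set_ordered \<alpha> by (metis nth_mem subsetD)+
  have entries: "mat n n (\<lambda>(p, q). coord (ordered n \<beta> ! q) (map e (ordered n \<alpha>) ! p))
      = mat n n (\<lambda>(p, q). if ordered n \<alpha> ! p = ordered n \<beta> ! q then 1 else 0)"
    using len mem by (intro eq_matI) (auto simp: coord_basis)
  show ?thesis
  proof (cases "\<alpha> = \<beta>")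
    case True
    have "mat n n (\<lambda>(p, q). if ordered n \<alpha> ! p = ordered n \<beta> ! q then 1 else 0) = (1\<^sub>m n :: 'a mat)"
      using len True distinct_ordered[of n \<alpha>] by (intro eq_matI) (auto simp: nth_eq_iff_index_eq)
    then show ?thesis using True unfolding minor_def entries by simp
  next
    case False
    \<comment> \<open>Distinct sets of equal size: an element of \<alpha> outside \<beta> produces a
      zero row.\<close>
    have "\<not> \<alpha> \<subseteq> \<beta>" using False \<alpha> card_subset_eq[of \<beta> \<alpha>] finite_subset[OF \<alpha>(2)] by auto
    then obtain a where a: "a \<in> \<alpha>" "a \<notin> \<beta>" by blast
    then obtain p where p: "p < n" "ordered n \<alpha> ! p = a"
      using set_ordered[OF \<alpha>(1)] len by (metis in_set_conv_nth)
    have "\<And>q. q < n \<Longrightarrow> a \<noteq> ordered n \<beta> ! q"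
      using a(2) set_ordered[OF \<alpha>(2)] len by (metis nth_mem)
    then have "det (mat n n (\<lambda>(p, q). if ordered n \<alpha> ! p = ordered n \<beta> ! q then 1 else 0)) = (0 :: 'a)"
      using p by (subst laplace_expansion_row[of _ n p]) (auto intro!: sum.neutral)
    then show ?thesis using False unfolding minor_def entries by simp
  qed
qed

lemma alternating_form_zeroI:
  assumes \<phi>: "alternating_form scale n \<phi>"
    and basis: "\<And>\<beta>. \<beta> \<in> index_set n (2 * n) \<Longrightarrow> \<phi> (map e (ordered n \<beta>)) = 0"
    and v: "length v = n"
  shows "\<phi> v = 0"
proof -
  have zero: "\<phi> (map e L) = 0" if L: "length L = n" "set L \<subseteq> {1..2 * n}" for L
  proof (cases "distinct L")
    case True
    then have \<beta>: "set L \<in> index_set n (2 * n)" using L by (auto simp: index_set_def distinct_card)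
    have m: "mset L = mset (ordered n (set L))"
      using set_ordered[OF L(2)] True distinct_ordered by (metis set_eq_iff_mset_eq_distinct)
    have "skew n (\<lambda>L. \<phi> (map e L))"
      by (rule skew_map[OF alternating_form_skew[OF \<phi>]])
    then show ?thesis
      by (rule skew_zero_mset[where f = "\<lambda>L. \<phi> (map e L)", OF _ index_set_length[OF \<beta>] m basis[OF \<beta>]])
  next
    case False
    then show ?thesis using L(1) by (intro alternating_form_not_distinct[OF \<phi>]) (auto simp: distinct_map)
  qed
  \<comment> \<open>Arguments are expanded in the basis from the last to the first:
    \<open>us\<close> holds those still arbitrary, \<open>L\<close> the basis indices already
    reached.\<close>
  have "\<phi> (us @ map e L) = 0" if "length us + length L = n" "set L \<subseteq> {1..2 * n}" for us L
    using that
  proof (induction us arbitrary: L rule: rev_induct)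
    case Nil
    then show ?case by (simp add: zero)
  next
    case (snoc x us)
    have len: "length us + length (map e L) + 1 = n" using snoc.prems(1) by simp
    have "\<phi> (us @ x # map e L) = (\<Sum>j = 1..2 * n. coord j x * \<phi> (us @ e j # map e L))"
      using alternating_form_sum_entry[OF \<phi> len, of "\<lambda>j. coord j x" e "{1..2 * n}"]
      unfolding coord_expansion[symmetric] .
    also have "\<dots> = 0"
    proof (intro sum.neutral ballI)
      fix j assume "j \<in> {1..2 * n}"
      then have "\<phi> (us @ map e (j # L)) = 0"
        using snoc.prems by (intro snoc.IH) auto
      then show "coord j x * \<phi> (us @ e j # map e L) = 0" by simp
    qed
    finally show ?case by simp
  qed
  from this[of v "[]"] show ?thesis using v by simp
qed

lemma alternating_form_expansion:
  assumes \<phi>: "alternating_form scale n \<phi>" and v: "length v = n"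
  shows "\<phi> v = (\<Sum>\<beta>\<in>index_set n (2 * n). \<phi> (map e (ordered n \<beta>)) * minor (ordered n \<beta>) v)"
proof -
  let ?\<psi> = "\<lambda>v. \<phi> v - (\<Sum>\<beta>\<in>index_set n (2 * n). \<phi> (map e (ordered n \<beta>)) * minor (ordered n \<beta>) v)"
  have "?\<psi> v = 0"
  proof (rule alternating_form_zeroI[OF _ _ v])
    show "alternating_form scale n ?\<psi>"
      by (intro alternating_form_diff \<phi> alternating_form_lincomb alternating_form_minor)
    fix \<alpha> assume "\<alpha> \<in> index_set n (2 * n)"
    then show "?\<psi> (map e (ordered n \<alpha>)) = 0"
      by (simp add: minor_basis if_distrib cong: if_cong)
  qed
  then show ?thesis by simp
qed

text \<open>Existence of the coordinates is the expansion of an alternating form. Uniqueness holds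
  because elements of the exterior power are functionals on forms, and evaluating at a minor
  isolates one coefficient.\<close>

lemma plucker_coords_wedge:
  assumes v: "length v = n"
  shows "plucker_coords scale n e (wedge scale v)
    = (\<lambda>\<beta>. if \<beta> \<in> index_set n (2 * n) then minor (ordered n \<beta>) v else 0)"
  unfolding plucker_coords_def
proof (rule the_equality, intro conjI allI impI)
  have bw: "basis_wedge scale n e \<alpha> \<phi> = (if alternating_form scale n \<phi> then \<phi> (map e (ordered n \<alpha>)) else 0)"
    if "\<alpha> \<in> index_set n (2 * n)" for \<alpha> \<phi>
    using index_set_length[OF that] by (simp add: basis_wedge_def wedge_def ordered_def)
  show "wedge scale v = (\<lambda>\<phi>. \<Sum>\<alpha>\<in>index_set n (2 * n).
      (if \<alpha> \<in> index_set n (2 * n) then minor (ordered n \<alpha>) v else 0) * basis_wedge scale n e \<alpha> \<phi>)"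
  proof
    fix \<phi>
    show "wedge scale v \<phi> = (\<Sum>\<alpha>\<in>index_set n (2 * n).
      (if \<alpha> \<in> index_set n (2 * n) then minor (ordered n \<alpha>) v else 0) * basis_wedge scale n e \<alpha> \<phi>)"
      using alternating_form_expansion[of \<phi> v] v by (simp add: wedge_def bw mult.commute)
  qed
  fix P
  assume P: "(\<forall>\<alpha>. \<alpha> \<notin> index_set n (2 * n) \<longrightarrow> P \<alpha> = 0) \<and>
    wedge scale v = (\<lambda>\<phi>. \<Sum>\<alpha>\<in>index_set n (2 * n). P \<alpha> * basis_wedge scale n e \<alpha> \<phi>)"
  show "P = (\<lambda>\<beta>. if \<beta> \<in> index_set n (2 * n) then minor (ordered n \<beta>) v else 0)"
  proof
    fix \<beta>
    have "minor (ordered n \<beta>) v = P \<beta>" if \<beta>: "\<beta> \<in> index_set n (2 * n)"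
    proof -
      have "minor (ordered n \<beta>) v = wedge scale v (minor (ordered n \<beta>))"
        using v by (simp add: wedge_def alternating_form_minor)
      also have "\<dots> = (\<Sum>\<alpha>\<in>index_set n (2 * n). P \<alpha> * basis_wedge scale n e \<alpha> (minor (ordered n \<beta>)))"
        using P by metis
      also have "\<dots> = (\<Sum>\<alpha>\<in>index_set n (2 * n). if \<alpha> = \<beta> then P \<alpha> else 0)"
        using \<beta> by (intro sum.cong) (auto simp: bw alternating_form_minor minor_basis)
      also have "\<dots> = P \<beta>" using \<beta> by simp
      finally show ?thesis .
    qed
    then show "P \<beta> = (if \<beta> \<in> index_set n (2 * n) then minor (ordered n \<beta>) v else 0)"
      using P by auto
  qed
qed auto

end

section \<open>Isotropic tuples\<close>


definition both :: "nat \<Rightarrow> nat set \<Rightarrow> nat set" where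
  "both n \<beta> = {i \<in> {1..n}. i \<in> \<beta> \<and> 2 * n - i + 1 \<in> \<beta>}"

definition singles :: "nat \<Rightarrow> nat set \<Rightarrow> nat set" where
  "singles n \<beta> = \<beta> - pairs n (both n \<beta>)"

definition neither :: "nat \<Rightarrow> nat set \<Rightarrow> nat set" where
  "neither n \<beta> = {i \<in> {1..n}. i \<notin> \<beta> \<and> 2 * n - i + 1 \<notin> \<beta>}"

lemma pairs_subset: "T \<subseteq> {1..n} \<Longrightarrow> pairs n T \<subseteq> {1..2 * n}"
  using pairs_all[of n] unfolding pairs_def by blast

lemma pairs_both_subset: "pairs n (both n \<beta>) \<subseteq> \<beta>"
  by (auto simp: pairs_def both_def)

lemma card_pairs:
  assumes "T \<subseteq> {1..n}"
  shows "card (pairs n T) = 2 * card T"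
proof -
  obtain L where L: "set L = T" "distinct L"
    using finite_distinct_list[of T] finite_subset[OF assms] by auto
  show ?thesis using distinct_card[OF distinct_pair_list[OF L(2)]] distinct_card[OF L(2)] L assms by simp
qed

lemma singles_un_both: "singles n \<beta> \<union> pairs n (both n \<beta>) = \<beta>"
  using pairs_both_subset by (auto simp: singles_def)

lemma both_subset: "both n \<beta> \<subseteq> {1..n}" and neither_subset: "neither n \<beta> \<subseteq> {1..n}"
  by (auto simp: both_def neither_def)

lemma both_singles: "both n (singles n \<beta>) = {}"
  by (auto simp: both_def singles_def pairs_def)

text \<open>Uniqueness of the splitting into S and T: both parts can be recovered from the union.
  This is what separates the blocks.\<close>

lemma both_union_pairs:
  assumes "both n S = {}" "S \<inter> pairs n T = {}" "T \<subseteq> {1..n}"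
  shows "both n (S \<union> pairs n T) = T" "singles n (S \<union> pairs n T) = S"
proof -
  show eq: "both n (S \<union> pairs n T) = T"
  proof (intro equalityI subsetI)
    fix i assume "i \<in> both n (S \<union> pairs n T)"
    then have i: "i \<in> {1..n}" "i \<in> S \<union> pairs n T" "Suc (2 * n - i) \<in> S \<union> pairs n T"
      by (auto simp: both_def)
    show "i \<in> T"
    proof (rule ccontr)
      assume "i \<notin> T"
      then have "i \<in> S" "Suc (2 * n - i) \<in> S" using i mem_pairs_iff[OF assms(3) i(1)] by auto
      then show False using assms(1) i(1) by (auto simp: both_def)
    qed
  next
    fix i assume i: "i \<in> T"
    then show "i \<in> both n (S \<union> pairs n T)" using assms(3) by (auto simp: both_def pairs_def)
  qed
  show "singles n (S \<union> pairs n T) = S"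
    unfolding singles_def eq using assms(2) by blast
qed

lemma disjoint_pairs_iff:
  assumes "T \<subseteq> {1..n}"
  shows "S \<inter> pairs n T = {} \<longleftrightarrow> T \<subseteq> neither n S"
  using assms by (auto simp: pairs_def neither_def)

lemma both_subset_neither_singles: "both n \<beta> \<subseteq> neither n (singles n \<beta>)"
proof -
  have "singles n \<beta> \<inter> pairs n (both n \<beta>) = {}" by (auto simp: singles_def)
  then show ?thesis using disjoint_pairs_iff[OF both_subset] by blast
qed

lemma card_singles:
  assumes "\<beta> \<subseteq> {1..2 * n}"
  shows "card (singles n \<beta>) + 2 * card (both n \<beta>) = card \<beta>"
proof -
  have "card \<beta> = card (singles n \<beta> \<union> pairs n (both n \<beta>))" by (simp add: singles_un_both)
  also have "\<dots> = card (singles n \<beta>) + card (pairs n (both n \<beta>))"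
    by (rule card_Un_disjoint)
      (use assms finite_subset[OF assms] finite_subset[OF pairs_both_subset] in \<open>auto simp: singles_def\<close>)
  finally show ?thesis by (simp add: card_pairs[OF both_subset])
qed

text \<open>Folding each index onto the smaller member of its pair is injective on a set without
  complete pairs, and the image is the complement of the free indices in
  \<open>{1..n}\<close>.\<close>

lemma card_neither:
  assumes "both n S = {}" "S \<subseteq> {1..2 * n}"
  shows "card (neither n S) + card S = n"
proof -
  define fold where "fold j = (if j \<le> n then j else 2 * n - j + 1)" for j
  have "inj_on fold S"
  proof (rule inj_onI)
    fix i j assume ij: "i \<in> S" "j \<in> S" "fold i = fold j"
    have r: "i \<in> {1..2 * n}" "j \<in> {1..2 * n}" using ij assms(2) by auto
    have "\<not> (i \<le> n \<and> j = 2 * n - i + 1)" "\<not> (j \<le> n \<and> i = 2 * n - j + 1)"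
      using assms(1) ij r by (auto simp: both_def)
    then show "i = j" using ij(3) r by (auto simp: fold_def split: if_splits)
  qed
  moreover have "fold ` S = {1..n} - neither n S"
  proof (intro equalityI subsetI)
    fix i assume "i \<in> fold ` S"
    then obtain j where j: "j \<in> S" "i = fold j" by blast
    have "j \<in> {1..2 * n}" using j assms(2) by auto
    then show "i \<in> {1..n} - neither n S" using j by (auto simp: fold_def neither_def)
  next
    fix i assume i: "i \<in> {1..n} - neither n S"
    then have "i \<in> S \<or> 2 * n - i + 1 \<in> S" by (auto simp: neither_def)
    moreover have "fold i = i" "fold (2 * n - i + 1) = i" using i by (auto simp: fold_def)
    ultimately show "i \<in> fold ` S" by (metis imageI)
  qed
  ultimately have "card S = card ({1..n} - neither n S)" by (metis card_image)
  also have "\<dots> = n - card (neither n S)"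
    using neither_subset by (subst card_Diff_subset) (auto intro: finite_subset)
  finally show ?thesis using card_mono[OF _ neither_subset[of n S]] by simp
qed

lemma singles_subset: "singles n \<beta> \<subseteq> \<beta>"
  by (auto simp: singles_def)

section \<open>The symplectic form and its isotropic tuples\<close>

context symplectic_space
begin

lemma form_add: "\<omega> (x + y) z = \<omega> x z + \<omega> y z" "\<omega> z (x + y) = \<omega> z x + \<omega> z y"
  and form_scale: "\<omega> (scale c x) z = c * \<omega> x z" "\<omega> z (scale c x) = c * \<omega> z x"
  using linear_left linear_right unfolding linear_functional_iff by blast+

lemma form_zero: "\<omega> 0 x = 0" "\<omega> x 0 = 0"
  using form_scale(1)[of 0 0 x] form_scale(2)[of x 0 0] by simp_all

lemma form_diff: "\<omega> (x - y) z = \<omega> x z - \<omega> y z" "\<omega> z (x - y) = \<omega> z x - \<omega> z y"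
  using form_add(1)[of "x - y" y z] form_add(2)[of z "x - y" y] by simp_all

lemma form_skew: "\<omega> x y = - \<omega> y x"
proof -
  have "\<omega> (x + y) (x + y) = \<omega> x y + \<omega> y x" unfolding form_add unfolding alternating by simp
  then show ?thesis unfolding alternating by (metis eq_neg_iff_add_eq_0)
qed

lemma form_sum: "\<omega> (\<Sum>j\<in>J. scale (c j) (u j)) z = (\<Sum>j\<in>J. c j * \<omega> (u j) z)"
  "\<omega> z (\<Sum>j\<in>J. scale (c j) (u j)) = (\<Sum>j\<in>J. c j * \<omega> z (u j))"
  by (induction J rule: infinite_finite_induct) (simp_all add: form_zero form_add form_scale)

lemma form_basis:
  assumes "i \<in> {1..2 * n}" "j \<in> {1..2 * n}"
  shows "\<omega> (e i) (e j) = (if i + j = 2 * n + 1 then if i < j then 1 else - 1 else 0)"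
proof (cases i j rule: linorder_cases)
  case less
  moreover have "j = 2 * n - i + 1 \<longleftrightarrow> i + j = 2 * n + 1" using assms by auto
  ultimately show ?thesis using basis_form[of i j] assms by simp
next
  case equal
  moreover have "i + i \<noteq> 2 * n + 1" by presburger
  ultimately show ?thesis using alternating by simp
next
  case greater
  moreover have "i = 2 * n - j + 1 \<longleftrightarrow> i + j = 2 * n + 1" using assms by auto
  ultimately show ?thesis using basis_form[of j i] assms form_skew[of "e i" "e j"] by simp
qed

text \<open>In coordinates, \<omega> is the antisymmetrisation of a bilinear form. Vanishing of
  \<open>\<omega> x y\<close> therefore says that the bilinear form is symmetric at x and y, which
  is how isotropy enters the computation with minors.\<close>

lemma form_coord:
  "\<omega> x y = (\<Sum>i = 1..n. coord i x * coord (2 * n - i + 1) y) - (\<Sum>i = 1..n. coord i y * coord (2 * n - i + 1) x)"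
proof -
  let ?f = "\<lambda>i. coord i x * coord (2 * n + 1 - i) y"
  have "\<omega> x y = \<omega> (\<Sum>i = 1..2 * n. scale (coord i x) (e i)) (\<Sum>j = 1..2 * n. scale (coord j y) (e j))"
    unfolding coord_expansion[symmetric] by (rule refl)
  also have "\<dots> = (\<Sum>i = 1..2 * n. \<Sum>j = 1..2 * n. coord j y * (coord i x * \<omega> (e i) (e j)))"
    unfolding form_sum sum_distrib_left by (rule sum.swap)
  also have "\<dots> = (\<Sum>i = 1..2 * n. (if i \<le> n then 1 else - 1) * ?f i)"
  proof (rule sum.cong)
    fix i assume i: "i \<in> {1..2 * n}"
    then have mem: "2 * n + 1 - i \<in> {1..2 * n}" by auto
    have "(\<Sum>j = 1..2 * n. coord j y * (coord i x * \<omega> (e i) (e j)))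
        = (\<Sum>j = 1..2 * n. if j = 2 * n + 1 - i then (if i \<le> n then 1 else - 1) * ?f i else 0)"
      using i by (intro sum.cong) (auto simp: form_basis)
    then show "(\<Sum>j = 1..2 * n. coord j y * (coord i x * \<omega> (e i) (e j))) = (if i \<le> n then 1 else - 1) * ?f i"
      using mem by (simp only: sum.delta[OF finite_atLeastAtMost] if_True)
  qed simp
  also have "\<dots> = (\<Sum>i = 1..n. (if i \<le> n then 1 else - 1) * ?f i) + (\<Sum>i = n + 1..2 * n. (if i \<le> n then 1 else - 1) * ?f i)"
    by (rule sum.ub_add_nat[of 1 n _ n, folded mult_2]) simp
  also have "(\<Sum>i = n + 1..2 * n. (if i \<le> n then 1 else - 1) * ?f i) = (\<Sum>i = n + 1..2 * n. - ?f i)"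
    by (intro sum.cong) auto
  also have "\<dots> = (\<Sum>i = 1..n. - (coord i y * coord (2 * n - i + 1) x))"
    by (rule sum.reindex_bij_witness[of _ "\<lambda>i. 2 * n + 1 - i" "\<lambda>i. 2 * n + 1 - i"])
      (auto simp: Suc_diff_le)
  also have "(\<Sum>i = 1..n. (if i \<le> n then 1 else - 1) * ?f i) = (\<Sum>i = 1..n. coord i x * coord (2 * n - i + 1) y)"
    by (intro sum.cong) (auto simp: Suc_diff_le)
  finally show ?thesis by (simp add: sum_negf)
qed

definition isotropic :: "'e list \<Rightarrow> bool" where
  "isotropic v \<longleftrightarrow> (\<forall>x\<in>set v. \<forall>y\<in>set v. \<omega> x y = 0)"

text \<open>Exchanging the rows that meet the first two columns changes the sign of every Leibniz term
  and, on an isotropic tuple, fixes the sum of the products over all hyperbolic pairs.\<close>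

lemma minor_pair_sum_zero:
  assumes "(2 :: 'a) \<noteq> 0" "n \<ge> 2" "length L = n - 2" "length v = n" "isotropic v"
  shows "(\<Sum>i = 1..n. minor (i # (2 * n - i + 1) # L) v) = 0"
proof -
  define A where "A p q = (\<Sum>i = 1..n. coord i (v ! p) * coord (2 * n - i + 1) (v ! q))" for p q
  define R where "R \<pi> = (\<Prod>q = 2..<n. coord (L ! (q - 2)) (v ! \<pi> q))" for \<pi> :: "nat \<Rightarrow> nat"
  define F where "F \<pi> = signof \<pi> * (A (\<pi> 0) (\<pi> 1) * R \<pi>)" for \<pi> :: "nat \<Rightarrow> nat"
  let ?S = "{\<pi>. \<pi> permutes {0..<n}}"
  have A_sym: "A p q = A q p" if "p < n" "q < n" for p q
  proof -
    have "\<omega> (v ! p) (v ! q) = 0" using assms(4,5) that by (simp add: isotropic_def)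
    then show ?thesis unfolding form_coord A_def by simp
  qed
  have minor: "minor (i # i' # L) v
      = (\<Sum>\<pi>\<in>?S. signof \<pi> * (coord i (v ! \<pi> 0) * coord i' (v ! \<pi> 1) * R \<pi>))" for i i'
  proof -
    let ?M = "mat n n (\<lambda>(p, q). coord ((i # i' # L) ! q) (v ! p))"
    \<comment> \<open>After transposition the Leibniz product runs over columns, so the hyperbolic
      pair always occupies the factors 0 and 1 and the remaining factor \<open>R\<close> does not
      depend on i.\<close>
    have "minor (i # i' # L) v = det (transpose_mat ?M)"
      unfolding minor_def by (intro det_transpose[symmetric, where n = n]) simp
    also have "\<dots> = (\<Sum>\<pi>\<in>?S. signof \<pi> * (\<Prod>q = 0..<n. transpose_mat ?M $$ (q, \<pi> q)))"
      by (intro det_def') simp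
    also have "\<dots> = (\<Sum>\<pi>\<in>?S. signof \<pi> * (coord i (v ! \<pi> 0) * coord i' (v ! \<pi> 1) * R \<pi>))"
    proof (rule sum.cong)
      fix \<pi> assume "\<pi> \<in> ?S"
      then have \<pi>: "\<pi> q < n" if "q < n" for q
        using that permutes_in_image[of \<pi> "{0..<n}" q] by auto
      have "(\<Prod>q = 0..<n. transpose_mat ?M $$ (q, \<pi> q)) = (\<Prod>q = 0..<n. coord ((i # i' # L) ! q) (v ! \<pi> q))"
        using \<pi> by (intro prod.cong) auto
      also have "\<dots> = coord i (v ! \<pi> 0) * (coord i' (v ! \<pi> 1) * (\<Prod>q = 2..<n. coord ((i # i' # L) ! q) (v ! \<pi> q)))"
        using assms(2) by (simp add: prod.atLeast_Suc_lessThan numeral_2_eq_2)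
      also have "(\<Prod>q = 2..<n. coord ((i # i' # L) ! q) (v ! \<pi> q)) = R \<pi>"
        unfolding R_def by (intro prod.cong) (auto simp: nth_Cons numeral_2_eq_2 split: nat.splits)
      finally show "signof \<pi> * (\<Prod>q = 0..<n. transpose_mat ?M $$ (q, \<pi> q))
          = signof \<pi> * (coord i (v ! \<pi> 0) * coord i' (v ! \<pi> 1) * R \<pi>)"
        by (simp add: mult.assoc)
    qed simp
    finally show ?thesis .
  qed
  have G: "(\<Sum>i = 1..n. minor (i # (2 * n - i + 1) # L) v) = sum F ?S"
    unfolding minor by (subst sum.swap) (simp add: F_def A_def sum_distrib_left sum_distrib_right)
  define \<tau> :: "nat \<Rightarrow> nat" where "\<tau> = transpose 0 1"
  have \<tau>: "\<tau> permutes {0..<n}" unfolding \<tau>_def using assms(2) by (intro permutes_swap_id) auto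
  have "sum F ?S = (\<Sum>\<pi>\<in>?S. F (\<pi> \<circ> \<tau>))" by (rule sum_permutations_compose_right[OF \<tau>])
  also have "\<dots> = (\<Sum>\<pi>\<in>?S. - F \<pi>)"
  proof (rule sum.cong)
    fix \<pi> assume \<pi>: "\<pi> \<in> ?S"
    have "signof (\<pi> \<circ> \<tau>) = (signof \<pi> * signof \<tau> :: 'a)"
      using \<pi> \<tau> by (intro signof_compose[of _ n]) (auto simp: atLeast0LessThan)
    moreover have "signof \<tau> = (- 1 :: 'a)" by (simp add: \<tau>_def sign_swap_id)
    moreover have "R (\<pi> \<circ> \<tau>) = R \<pi>" unfolding R_def \<tau>_def by (intro prod.cong) (auto simp: transpose_def)
    moreover have "A (\<pi> 1) (\<pi> 0) = A (\<pi> 0) (\<pi> 1)"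
      using \<pi> assms(2) permutes_in_image[of \<pi> "{0..<n}"] by (intro A_sym) auto
    ultimately show "F (\<pi> \<circ> \<tau>) = - F \<pi>" by (simp add: F_def \<tau>_def)
  qed simp
  finally have "sum F ?S = - sum F ?S" by (simp add: sum_negf)
  then have "2 * sum F ?S = 0" by (metis mult_2 eq_neg_iff_add_eq_0)
  then show ?thesis using G assms(1) by simp
qed

text \<open>The multilinear counterpart of \<open>matching_sum\<close>: it evaluates the form on a
  product of differences of hyperbolic pairs wedged with w. The accumulator is a tuple instead of a
  set, so that isotropic planes outside the basis can be inserted.\<close>

fun pair_sum :: "('e list \<Rightarrow> 'a) \<Rightarrow> (nat \<times> nat) list \<Rightarrow> 'e list \<Rightarrow> 'a" where
  "pair_sum \<Phi> [] w = \<Phi> w"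
| "pair_sum \<Phi> ((a, b) # M) w = pair_sum \<Phi> M (e a # e (2 * n - a + 1) # w)
     - pair_sum \<Phi> M (e b # e (2 * n - b + 1) # w)"

lemma pair_sum_add:
  assumes "alternating_form scale n \<Phi>" "length xs + length ys + 1 + 2 * length M = n"
  shows "pair_sum \<Phi> M (xs @ (x + y) # ys) = pair_sum \<Phi> M (xs @ x # ys) + pair_sum \<Phi> M (xs @ y # ys)"
  using assms(2)
proof (induction M arbitrary: xs)
  case Nil
  then show ?case by (simp add: alternating_form_add[OF assms(1)])
next
  case (Cons p M)
  obtain a b where p: "p = (a, b)" by (cases p)
  show ?case
    using Cons.IH[of "e a # e (2 * n - a + 1) # xs"] Cons.IH[of "e b # e (2 * n - b + 1) # xs"] Cons.prems p
    by simp
qed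

lemma pair_sum_diff:
  assumes "alternating_form scale n \<Phi>" "length xs + length ys + 1 + 2 * length M = n"
  shows "pair_sum \<Phi> M (xs @ (x - y) # ys) = pair_sum \<Phi> M (xs @ x # ys) - pair_sum \<Phi> M (xs @ y # ys)"
  using pair_sum_add[OF assms, of "x - y" y] by simp

text \<open>With \<open>i' = 2 * n - i + 1\<close>, the difference \<open>e\<^sub>a \<and> e\<^bsub>a'\<^esub> - e\<^sub>b \<and> e\<^bsub>b'\<^esub>\<close> of hyperbolic
  pairs is the combination
  \<open>e\<^sub>a \<and> e\<^bsub>b'\<^esub> - e\<^sub>b \<and> e\<^bsub>a'\<^esub> - (e\<^sub>a + e\<^sub>b) \<and> (e\<^bsub>b'\<^esub> - e\<^bsub>a'\<^esub>)\<close> of isotropic planes.\<close>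

lemma pair_sum_zero:
  assumes \<Phi>: "alternating_form scale n \<Phi>"
    and vanish: "\<And>v. length v = n \<Longrightarrow> isotropic v \<Longrightarrow> \<Phi> v = 0"
    and "matching M" "support M \<subseteq> {1..n}" "length w + 2 * length M = n" "isotropic w"
    and "\<And>c x. c \<in> support M \<Longrightarrow> x \<in> set w \<Longrightarrow> \<omega> (e c) x = 0 \<and> \<omega> (e (2 * n - c + 1)) x = 0"
  shows "pair_sum \<Phi> M w = 0"
  using assms(3-)
proof (induction M arbitrary: w)
  case Nil
  then show ?case by (simp add: vanish)
next
  case (Cons p M)
  obtain a b where p: "p = (a, b)" by (cases p)
  define a' b' where "a' = 2 * n - a + 1" and "b' = 2 * n - b + 1"
  have ab: "a \<in> {1..n}" "b \<in> {1..n}" "a \<noteq> b" "a \<notin> support M" "b \<notin> support M"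
    using Cons.prems(1,2) p by auto
  have r: "a \<in> {1..2 * n}" "b \<in> {1..2 * n}" "a' \<in> {1..2 * n}" "b' \<in> {1..2 * n}"
    using ab by (auto simp: a'_def b'_def)
  have orth_w: "\<omega> (e c) x = 0" if "c \<in> {a, b, a', b'}" "x \<in> set w" for c x
    using Cons.prems(5)[of a x] Cons.prems(5)[of b x] that p by (auto simp: a'_def b'_def)
  have orth_M: "\<omega> (e c) (e d) = 0 \<and> \<omega> (e (2 * n - c + 1)) (e d) = 0"
    if "c \<in> support M" "d \<in> {a, b, a', b'}" for c d
  proof -
    have c: "c \<in> {1..n}" "c \<noteq> a" "c \<noteq> b" using that ab Cons.prems(2) p by auto
    have "c + d \<noteq> 2 * n + 1" "(2 * n - c + 1) + d \<noteq> 2 * n + 1"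
      using that(2) c ab by (auto simp: a'_def b'_def)
    moreover have "c \<in> {1..2 * n}" "2 * n - c + 1 \<in> {1..2 * n}" "d \<in> {1..2 * n}"
      using c that(2) r by auto
    ultimately show ?thesis by (simp add: form_basis)
  qed
  have forms: "\<omega> (e a) (e b') = 0" "\<omega> (e b) (e a') = 0" "\<omega> (e a) (e a') = 1" "\<omega> (e b) (e b') = 1"
    using form_basis[of a b'] form_basis[of b a'] form_basis[of a a'] form_basis[of b b'] ab r
    by (auto simp: a'_def b'_def)
  \<comment> \<open>An isotropic plane orthogonal to w and to all pairs still to be processed may be
    absorbed into w, which keeps every hypothesis of the induction.\<close>
  have zero: "pair_sum \<Phi> M (x # y # w) = 0"
    if xy: "\<omega> x y = 0" "\<And>z. z \<in> set w \<Longrightarrow> \<omega> x z = 0 \<and> \<omega> y z = 0"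
      "\<And>c. c \<in> support M \<Longrightarrow> \<omega> (e c) x = 0 \<and> \<omega> (e (2 * n - c + 1)) x = 0"
      "\<And>c. c \<in> support M \<Longrightarrow> \<omega> (e c) y = 0 \<and> \<omega> (e (2 * n - c + 1)) y = 0" for x y
  proof (rule Cons.IH)
    have "\<omega> y x = 0" "\<And>z. z \<in> set w \<Longrightarrow> \<omega> z x = 0 \<and> \<omega> z y = 0"
      using xy(1,2) form_skew by (metis neg_equal_0_iff_equal)+
    then show "isotropic (x # y # w)"
      using Cons.prems(4) xy(1,2) alternating by (auto simp: isotropic_def)
    fix c z assume "c \<in> support M" "z \<in> set (x # y # w)"
    then show "\<omega> (e c) z = 0 \<and> \<omega> (e (2 * n - c + 1)) z = 0"
      using xy(3,4) Cons.prems(5)[of c z] p by auto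
  qed (use Cons.prems p in auto)
  have 1: "pair_sum \<Phi> M (e a # e b' # w) = 0" "pair_sum \<Phi> M (e b # e a' # w) = 0"
    by (rule zero; use forms orth_w orth_M in auto)+
  \<comment> \<open>Isotropic because a and b are at most n: the contributions of the two hyperbolic
    pairs are 1 and -1 and cancel.\<close>
  have 2: "pair_sum \<Phi> M ((e a + e b) # (e b' - e a') # w) = 0"
    by (rule zero; use forms orth_w orth_M in \<open>auto simp: form_add form_diff\<close>)
  have len: "length w + 2 + 2 * length M = n" using Cons.prems(3) by simp
  have "pair_sum \<Phi> M ((e a + e b) # (e b' - e a') # w)
      = pair_sum \<Phi> M (e a # (e b' - e a') # w) + pair_sum \<Phi> M (e b # (e b' - e a') # w)"
    using pair_sum_add[OF \<Phi>, of "[]" "(e b' - e a') # w" M] len by simp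
  also have "pair_sum \<Phi> M (e a # (e b' - e a') # w) = pair_sum \<Phi> M (e a # e b' # w) - pair_sum \<Phi> M (e a # e a' # w)"
    using pair_sum_diff[OF \<Phi>, of "[e a]" w M] len by simp
  also have "pair_sum \<Phi> M (e b # (e b' - e a') # w) = pair_sum \<Phi> M (e b # e b' # w) - pair_sum \<Phi> M (e b # e a' # w)"
    using pair_sum_diff[OF \<Phi>, of "[e b]" w M] len by simp
  finally show ?case using 1 2 p by (simp add: a'_def b'_def)
qed

text \<open>Both recursions make the same choices, recorded in L. At the end the chosen pairs stand
  in front of S, and \<open>skew_ordered\<close> brings them into canonical position without a
  sign.\<close>

lemma pair_sum_eq_matching_sum:
  assumes \<Phi>: "alternating_form scale n \<Phi>"
    and "matching M" "support M \<subseteq> {1..n}" "distinct L" "set L \<subseteq> {1..n}" "set L \<inter> support M = {}"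
    and "S \<inter> pairs n (set L \<union> support M) = {}" "S \<subseteq> {1..2 * n}" "card S + 2 * (length L + length M) = n"
  shows "pair_sum \<Phi> M (map e (pair_list n L @ ordered n S))
    = matching_sum (\<lambda>T. \<Phi> (map e (ordered n (S \<union> pairs n T)))) M (set L)"
  using assms(2-)
proof (induction M arbitrary: L)
  case Nil
  have "skew n (\<lambda>L. \<Phi> (map e L))" by (rule skew_map[OF alternating_form_skew[OF \<Phi>]])
  then have "\<Phi> (map e (ordered n (S \<union> pairs n (set L)))) = \<Phi> (map e (pair_list n L @ ordered n S))"
    by (rule skew_ordered) (use Nil.prems in auto)
  then show ?case by simp
next
  case (Cons p M)
  obtain a b where p: "p = (a, b)" by (cases p)
  have "pair_sum \<Phi> M (map e (pair_list n (c # L) @ ordered n S))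
      = matching_sum (\<lambda>T. \<Phi> (map e (ordered n (S \<union> pairs n T)))) M (set (c # L))" if "c \<in> {a, b}" for c
  proof (rule Cons.IH)
    have "pairs n (set (c # L) \<union> support M) \<subseteq> pairs n (set L \<union> support (p # M))"
      using that p by (auto simp: pairs_def)
    then show "S \<inter> pairs n (set (c # L) \<union> support M) = {}" using Cons.prems(6) by blast
  qed (use Cons.prems that p in auto)
  from this[of a] this[of b] show ?case by (simp add: p)
qed

lemma isotropic_map_ordered:
  assumes "both n S = {}" "S \<subseteq> {1..2 * n}"
  shows "isotropic (map e (ordered n S))"
  unfolding isotropic_def
proof (intro ballI)
  fix x y assume "x \<in> set (map e (ordered n S))" "y \<in> set (map e (ordered n S))"
  then obtain i j where ij: "i \<in> S" "j \<in> S" "x = e i" "y = e j"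
    using set_ordered[OF assms(2)] by auto
  have r: "i \<in> {1..2 * n}" "j \<in> {1..2 * n}" using ij assms(2) by auto
  have "i + j \<noteq> 2 * n + 1"
  proof
    assume *: "i + j = 2 * n + 1"
    then have "j = 2 * n - i + 1" "i = 2 * n - j + 1" "i \<le> n \<or> j \<le> n" using r by auto
    then have "i \<in> both n S \<or> j \<in> both n S" using ij r by (auto simp: both_def)
    then show False using assms(1) by blast
  qed
  then show "\<omega> x y = 0" using ij r by (simp add: form_basis)
qed

text \<open>The vectors indexed by S form an isotropic tuple orthogonal to every pair of free
  indices, and j of these pairs complete it to n entries. There are 2j free indices, so the
  matchings tested are perfect.\<close>

lemma annihilator_block:
  assumes \<Phi>: "alternating_form scale n \<Phi>"
    and vanish: "\<And>v. length v = n \<Longrightarrow> isotropic v \<Longrightarrow> \<Phi> v = 0"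
    and S: "both n S = {}" "S \<subseteq> {1..2 * n}" "card S + 2 * j = n" and f: "(of_nat (fact j) :: 'a) \<noteq> 0"
  shows "\<exists>g. \<forall>T\<subseteq>neither n S. card T = j \<longrightarrow>
    \<Phi> (map e (ordered n (S \<union> pairs n T))) = (\<Sum>x\<in>T. g (T - {x}))"
proof (rule shadow_sum_if_matching_sums_zero)
  show "finite (neither n S)" by (rule finite_subset[OF neither_subset]) simp
  show "2 * j \<le> card (neither n S) + 1" using card_neither[OF S(1,2)] S(3) by simp
  show "(of_nat (fact j) :: 'a) \<noteq> 0" by (rule f)
  fix M assume M: "matching M" "support M \<subseteq> neither n S" "length M = j"
  have sup: "support M \<subseteq> {1..n}" using M(2) neither_subset by blast
  have "matching_sum (\<lambda>T. \<Phi> (map e (ordered n (S \<union> pairs n T)))) M (set [])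
      = pair_sum \<Phi> M (map e (pair_list n [] @ ordered n S))"
    by (rule pair_sum_eq_matching_sum[symmetric, OF \<Phi> M(1) sup])
      (use M S disjoint_pairs_iff[OF sup] in auto)
  also have "\<dots> = 0"
  proof (rule pair_sum_zero[OF \<Phi> vanish M(1) sup])
    fix c x assume c: "c \<in> support M" and x: "x \<in> set (map e (pair_list n [] @ ordered n S))"
    obtain j where j: "j \<in> S" "x = e j" using x set_ordered[OF S(2)] by auto
    have "c \<in> {1..n}" "c \<notin> S" "2 * n - c + 1 \<notin> S" using c M(2) by (auto simp: neither_def)
    moreover have "j \<in> {1..2 * n}" using j S(2) by auto
    moreover have "c \<noteq> j" "2 * n - c + 1 \<noteq> j" using j calculation by auto
    then have "c + j \<noteq> 2 * n + 1" "(2 * n - c + 1) + j \<noteq> 2 * n + 1"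
      using calculation by auto
    moreover have "c \<in> {1..2 * n}" "2 * n - c + 1 \<in> {1..2 * n}" using calculation(1) by auto
    ultimately show "\<omega> (e c) x = 0 \<and> \<omega> (e (2 * n - c + 1)) x = 0"
      using j by (simp add: form_basis)
  qed (use M S isotropic_map_ordered in \<open>auto simp: length_ordered\<close>)
  finally show "matching_sum (\<lambda>T. \<Phi> (map e (ordered n (S \<union> pairs n T)))) M {} = 0" by simp
qed

text \<open>Removing a complete pair changes T but not S. The functions found for the separate
  blocks therefore combine into one function G of index sets with n - 2 elements.\<close>

lemma annihilator_form:
  assumes \<Phi>: "alternating_form scale n \<Phi>"
    and vanish: "\<And>v. length v = n \<Longrightarrow> isotropic v \<Longrightarrow> \<Phi> v = 0"
    and f: "\<And>j. 2 * j \<le> n \<Longrightarrow> (of_nat (fact j) :: 'a) \<noteq> 0"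
  obtains G where "\<And>\<beta>. \<beta> \<in> index_set n (2 * n) \<Longrightarrow>
    \<Phi> (map e (ordered n \<beta>)) = (\<Sum>i\<in>both n \<beta>. G (\<beta> - {i, 2 * n - i + 1}))"
proof -
  have "\<exists>g. \<forall>T\<subseteq>neither n S. card S + 2 * card T = n \<longrightarrow>
      \<Phi> (map e (ordered n (S \<union> pairs n T))) = (\<Sum>x\<in>T. g (T - {x}))"
    if S: "both n S = {}" "S \<subseteq> {1..2 * n}" for S
  proof (cases "\<exists>j. card S + 2 * j = n")
    case True
    then obtain j where j: "card S + 2 * j = n" by blast
    have "\<exists>g. \<forall>T\<subseteq>neither n S. card T = j \<longrightarrow>
        \<Phi> (map e (ordered n (S \<union> pairs n T))) = (\<Sum>x\<in>T. g (T - {x}))"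
      using j by (intro annihilator_block[OF \<Phi> vanish S] f) auto
    moreover have "card T = j" if "card S + 2 * card T = n" for T using j that by simp
    ultimately show ?thesis by metis
  next
    case False
    then show ?thesis by blast
  qed
  then obtain g where g: "\<And>S T. both n S = {} \<Longrightarrow> S \<subseteq> {1..2 * n} \<Longrightarrow> T \<subseteq> neither n S \<Longrightarrow>
      card S + 2 * card T = n \<Longrightarrow> \<Phi> (map e (ordered n (S \<union> pairs n T))) = (\<Sum>x\<in>T. g S (T - {x}))"
    by metis
  show ?thesis
  \<comment> \<open>An index set determines its block by \<open>singles\<close> and its place in the
    block by \<open>both\<close>.\<close>
  proof (rule that[of "\<lambda>\<alpha>. g (singles n \<alpha>) (both n \<alpha>)"])
    fix \<beta> assume "\<beta> \<in> index_set n (2 * n)"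
    then have \<beta>: "\<beta> \<subseteq> {1..2 * n}" "card \<beta> = n" by (auto simp: index_set_def)
    define S T where "S = singles n \<beta>" and "T = both n \<beta>"
    have S: "both n S = {}" "S \<subseteq> {1..2 * n}" "T \<subseteq> neither n S" "T \<subseteq> {1..n}"
      using both_singles both_subset_neither_singles singles_subset \<beta>(1) both_subset
      unfolding S_def T_def by blast+
    have \<beta>_eq: "\<beta> = S \<union> pairs n T" by (simp add: S_def T_def singles_un_both)
    have "\<Phi> (map e (ordered n \<beta>)) = (\<Sum>x\<in>T. g S (T - {x}))"
      unfolding \<beta>_eq by (rule g[OF S(1-3)]) (use card_singles[OF \<beta>(1)] \<beta>(2) in \<open>simp add: S_def T_def\<close>)
    also have "\<dots> = (\<Sum>i\<in>T. g (singles n (\<beta> - {i, 2 * n - i + 1})) (both n (\<beta> - {i, 2 * n - i + 1})))"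
    proof (rule sum.cong)
      fix i assume i: "i \<in> T"
      have disj: "S \<inter> pairs n T = {}" using disjoint_pairs_iff[OF S(4)] S(3) by blast
      have "pairs n T = insert i (insert (2 * n - i + 1) (pairs n (T - {i})))"
        using i pairs_simps(2)[of n i "T - {i}"] by (simp add: insert_absorb)
      moreover have "i \<notin> pairs n (T - {i})" "2 * n - i + 1 \<notin> pairs n (T - {i})"
        using mem_pairs_iff[of "T - {i}" n i] i S(4) by (simp_all add: subset_iff)
      ultimately have "\<beta> - {i, 2 * n - i + 1} = S \<union> pairs n (T - {i})"
        unfolding \<beta>_eq using disj by blast
      moreover have Ti: "T - {i} \<subseteq> {1..n}" using S(4) by blast
      moreover have "S \<inter> pairs n (T - {i}) = {}" using disj by (auto simp: pairs_def)
      ultimately show "g S (T - {i}) = g (singles n (\<beta> - {i, 2 * n - i + 1})) (both n (\<beta> - {i, 2 * n - i + 1}))"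
        using both_union_pairs[OF S(1), of "T - {i}"] S(4) Ti by simp
    qed simp
    finally show "\<Phi> (map e (ordered n \<beta>))
        = (\<Sum>i\<in>both n \<beta>. g (singles n (\<beta> - {i, 2 * n - i + 1})) (both n (\<beta> - {i, 2 * n - i + 1})))"
      by (simp add: T_def)
  qed
qed

end

section \<open>The coefficient matrix\<close>


text \<open>Keeps the matrix numbering of \<open>index_list\<close> but has sets as entries, so that
  sums over positions become sums over \<open>index_set\<close>.\<close>

definition subset_list :: "nat \<Rightarrow> nat \<Rightarrow> nat set list" where
  "subset_list l m = map set (index_list l m)"

lemma length_subset_list [simp]: "length (subset_list l m) = m choose l"
  by (simp add: subset_list_def length_index_list)

lemma nth_subset_list: "i < m choose l \<Longrightarrow> subset_list l m ! i = set (index_list l m ! i)"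
  by (simp add: subset_list_def length_index_list)

lemma set_subset_list [simp]: "set (subset_list l m) = index_set l m"
proof (intro equalityI subsetI)
  fix \<alpha> assume "\<alpha> \<in> set (subset_list l m)"
  then obtain L where "sorted_wrt (<) L" "set L \<subseteq> {1..m}" "length L = l" "\<alpha> = set L"
    by (auto simp: subset_list_def set_index_list)
  then show "\<alpha> \<in> index_set l m"
    by (auto simp: index_set_def distinct_card strict_sorted_iff)
next
  fix \<alpha> assume \<alpha>: "\<alpha> \<in> index_set l m"
  then have "finite \<alpha>" by (auto simp: index_set_def intro: finite_subset)
  then have "sorted_list_of_set \<alpha> \<in> set (index_list l m)" "set (sorted_list_of_set \<alpha>) = \<alpha>"
    using \<alpha> by (auto simp: set_index_list index_set_def)
  then show "\<alpha> \<in> set (subset_list l m)" by (force simp: subset_list_def)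
qed

lemma distinct_subset_list [simp]: "distinct (subset_list l m)"
proof -
  have "distinct xs" if "sorted_wrt (\<lambda>\<alpha> \<beta>. (\<alpha>, \<beta>) \<in> lexord {(i, j). i < j}) xs" for xs :: "nat list list"
    using that by (induction xs) (auto simp: lexord_irreflexive)
  then have "distinct (index_list l m)" using index_list_lexicographic by blast
  moreover have "inj_on set (set (index_list l m))"
    by (rule inj_onI) (auto simp: set_index_list intro: strict_sorted_equal)
  ultimately show ?thesis by (simp add: subset_list_def distinct_map)
qed

lemma sum_nth_distinct:
  assumes "distinct xs"
  shows "(\<Sum>b = 0..<length xs. f (xs ! b)) = sum f (set xs)"
  using assms by (metis (no_types, lifting) sum_list_distinct_conv_sum_set sum_list_sum_nth length_map nth_map sum.cong atLeastLessThan_iff)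

lemma sum_subset_list: "(\<Sum>b = 0..<m choose l. f (subset_list l m ! b)) = sum f (index_set l m)"
  using sum_nth_distinct[of "subset_list l m" f] by simp

lemma nth_subset_list_mem: "i < m choose l \<Longrightarrow> subset_list l m ! i \<in> index_set l m"
  using nth_mem[of i "subset_list l m"] by simp

lemma B_LG_carrier [simp]: "B_LG n \<in> carrier_mat ((2 * n) choose (n - 2)) ((2 * n) choose n)"
  by (simp add: B_LG_def)

lemma B_LG_entry:
  assumes "a < (2 * n) choose (n - 2)" "b < (2 * n) choose n"
  shows "B_LG n $$ (a, b) = Pi_form n (subset_list (n - 2) (2 * n) ! a)
    (\<lambda>\<gamma>. if \<gamma> = subset_list n (2 * n) ! b then 1 else 0)"
  using assms by (simp add: B_LG_def nth_subset_list)

text \<open>Since \<alpha> has n - 2 elements, the union reaches size n exactly when both partners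
  are new.\<close>

lemma Pi_coeff_eq:
  assumes "n \<ge> 2" "\<alpha> \<in> index_set (n - 2) (2 * n)" "i \<in> {1..n}"
  shows "Pi_coeff n \<alpha> i = (if i \<in> neither n \<alpha> then 1 else 0)"
proof -
  have \<alpha>: "finite \<alpha>" "card \<alpha> = n - 2" using assms(2) by (auto simp: index_set_def intro: finite_subset)
  have "i \<noteq> 2 * n - i + 1" using assms(3) by auto
  then have "card (\<alpha> \<union> {i, 2 * n - i + 1}) = n \<longleftrightarrow> i \<notin> \<alpha> \<and> 2 * n - i + 1 \<notin> \<alpha>"
    using \<alpha> assms(1) by (auto simp: card_insert_if)
  then show ?thesis using assms(3) by (simp add: Pi_coeff_def neither_def)
qed

lemma union_pair_mem_index_set:
  assumes "n \<ge> 2" "\<alpha> \<in> index_set (n - 2) (2 * n)" "i \<in> neither n \<alpha>"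
  shows "\<alpha> \<union> {i, 2 * n - i + 1} \<in> index_set n (2 * n)"
proof -
  have i: "i \<in> {1..n}" "i \<noteq> 2 * n - i + 1" "i \<notin> \<alpha>" "2 * n - i + 1 \<notin> \<alpha>" using assms(3) by (auto simp: neither_def)
  have \<alpha>: "finite \<alpha>" "card \<alpha> = n - 2" "\<alpha> \<subseteq> {1..2 * n}"
    using assms(2) by (auto simp: index_set_def intro: finite_subset)
  have "card (\<alpha> \<union> {i, 2 * n - i + 1}) = n" using \<alpha> i assms(1) by (auto simp: card_insert_if)
  moreover have "\<alpha> \<union> {i, 2 * n - i + 1} \<subseteq> {1..2 * n}" using \<alpha>(3) i(1) by auto
  ultimately show ?thesis by (simp add: index_set_def)
qed

lemma Pi_form_eq:
  assumes "n \<ge> 2" "\<alpha> \<in> index_set (n - 2) (2 * n)"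
  shows "Pi_form n \<alpha> X = (\<Sum>i\<in>neither n \<alpha>. X (\<alpha> \<union> {i, 2 * n - i + 1}))"
proof -
  have "Pi_form n \<alpha> X = (\<Sum>i = 1..n. if i \<in> neither n \<alpha> then X (\<alpha> \<union> {i, 2 * n - i + 1}) else 0)"
    unfolding Pi_form_def using assms by (intro sum.cong) (auto simp: Pi_coeff_eq)
  also have "\<dots> = (\<Sum>i\<in>{1..n} \<inter> neither n \<alpha>. X (\<alpha> \<union> {i, 2 * n - i + 1}))"
    by (rule sum.inter_restrict[symmetric]) simp
  also have "{1..n} \<inter> neither n \<alpha> = neither n \<alpha>" using neither_subset by blast
  finally show ?thesis .
qed

lemma sum_Pi_form:
  assumes "n \<ge> 2" "\<alpha> \<in> index_set (n - 2) (2 * n)"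
  shows "(\<Sum>\<beta>\<in>index_set n (2 * n). Pi_form n \<alpha> (\<lambda>\<gamma>. if \<gamma> = \<beta> then 1 else 0) * P \<beta>) = Pi_form n \<alpha> P"
proof -
  have "(\<Sum>\<beta>\<in>index_set n (2 * n). Pi_form n \<alpha> (\<lambda>\<gamma>. if \<gamma> = \<beta> then 1 else 0) * P \<beta>)
      = (\<Sum>i\<in>neither n \<alpha>. \<Sum>\<beta>\<in>index_set n (2 * n). if \<alpha> \<union> {i, 2 * n - i + 1} = \<beta> then P \<beta> else 0)"
    unfolding Pi_form_eq[OF assms] sum_distrib_right by (subst sum.swap) (auto intro!: sum.cong)
  also have "\<dots> = (\<Sum>i\<in>neither n \<alpha>. P (\<alpha> \<union> {i, 2 * n - i + 1}))"
  proof (rule sum.cong)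
    fix i assume "i \<in> neither n \<alpha>"
    from union_pair_mem_index_set[OF assms this]
    show "(\<Sum>\<beta>\<in>index_set n (2 * n). if \<alpha> \<union> {i, 2 * n - i + 1} = \<beta> then P \<beta> else 0)
        = P (\<alpha> \<union> {i, 2 * n - i + 1})"
      by (simp only: sum.delta'[OF finite_index_set] if_True)
  qed simp
  finally show ?thesis by (simp add: Pi_form_eq[OF assms])
qed

lemma neither_union_pair_iff:
  assumes "\<beta> \<in> index_set n (2 * n)"
  shows "\<alpha> \<in> index_set (n - 2) (2 * n) \<and> i \<in> neither n \<alpha> \<and> \<alpha> \<union> {i, 2 * n - i + 1} = \<beta>
    \<longleftrightarrow> i \<in> both n \<beta> \<and> \<alpha> = \<beta> - {i, 2 * n - i + 1}"
proof
  assume "\<alpha> \<in> index_set (n - 2) (2 * n) \<and> i \<in> neither n \<alpha> \<and> \<alpha> \<union> {i, 2 * n - i + 1} = \<beta>"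
  then show "i \<in> both n \<beta> \<and> \<alpha> = \<beta> - {i, 2 * n - i + 1}" by (auto simp: both_def neither_def)
next
  assume *: "i \<in> both n \<beta> \<and> \<alpha> = \<beta> - {i, 2 * n - i + 1}"
  then have i: "i \<in> {1..n}" "i \<in> \<beta>" "2 * n - i + 1 \<in> \<beta>" "i \<noteq> 2 * n - i + 1" by (auto simp: both_def)
  have \<beta>: "finite \<beta>" "card \<beta> = n" "\<beta> \<subseteq> {1..2 * n}"
    using assms by (auto simp: index_set_def intro: finite_subset)
  have "card (\<beta> - {i, 2 * n - i + 1}) = n - 2"
    using \<beta> i by (subst card_Diff_subset) (auto simp: numeral_2_eq_2)
  then have "\<alpha> \<in> index_set (n - 2) (2 * n)" using * \<beta>(3) by (auto simp: index_set_def)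
  moreover have "i \<in> neither n \<alpha>" using i(1) * by (auto simp: neither_def)
  moreover have "\<alpha> \<union> {i, 2 * n - i + 1} = \<beta>" using i * by auto
  ultimately show "\<alpha> \<in> index_set (n - 2) (2 * n) \<and> i \<in> neither n \<alpha> \<and> \<alpha> \<union> {i, 2 * n - i + 1} = \<beta>" by blast
qed

text \<open>The product of a row vector G with a column of \<open>B_LG\<close>. It has exactly the
  shape that \<open>annihilator_form\<close> yields, so G can serve as a row of P.\<close>

lemma sum_Pi_form_transpose:
  assumes "n \<ge> 2" "\<beta> \<in> index_set n (2 * n)"
  shows "(\<Sum>\<alpha>\<in>index_set (n - 2) (2 * n). G \<alpha> * Pi_form n \<alpha> (\<lambda>\<gamma>. if \<gamma> = \<beta> then 1 else 0))
    = (\<Sum>i\<in>both n \<beta>. G (\<beta> - {i, 2 * n - i + 1}))"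
proof -
  have "(\<Sum>\<alpha>\<in>index_set (n - 2) (2 * n). G \<alpha> * Pi_form n \<alpha> (\<lambda>\<gamma>. if \<gamma> = \<beta> then 1 else 0))
      = (\<Sum>\<alpha>\<in>index_set (n - 2) (2 * n). \<Sum>i = 1..n. if i \<in> neither n \<alpha> \<and> \<alpha> \<union> {i, 2 * n - i + 1} = \<beta> then G \<alpha> else 0)"
    unfolding Pi_form_def sum_distrib_left using assms(1)
    by (intro sum.cong) (auto simp: Pi_coeff_eq)
  also have "\<dots> = (\<Sum>i = 1..n. \<Sum>\<alpha>\<in>index_set (n - 2) (2 * n). if i \<in> neither n \<alpha> \<and> \<alpha> \<union> {i, 2 * n - i + 1} = \<beta> then G \<alpha> else 0)"
    by (rule sum.swap)
  also have "\<dots> = (\<Sum>i = 1..n. if i \<in> both n \<beta> then G (\<beta> - {i, 2 * n - i + 1}) else 0)"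
  proof (rule sum.cong)
    fix i
    have "(\<Sum>\<alpha>\<in>index_set (n - 2) (2 * n). if i \<in> neither n \<alpha> \<and> \<alpha> \<union> {i, 2 * n - i + 1} = \<beta> then G \<alpha> else 0)
      = (\<Sum>\<alpha>\<in>{\<alpha> \<in> index_set (n - 2) (2 * n). i \<in> neither n \<alpha> \<and> \<alpha> \<union> {i, 2 * n - i + 1} = \<beta>}. G \<alpha>)"
      by (rule sum.inter_filter[symmetric]) simp
    also have "{\<alpha> \<in> index_set (n - 2) (2 * n). i \<in> neither n \<alpha> \<and> \<alpha> \<union> {i, 2 * n - i + 1} = \<beta>}
      = (if i \<in> both n \<beta> then {\<beta> - {i, 2 * n - i + 1}} else {})"
      using neither_union_pair_iff[OF assms(2), of _ i] by auto
    finally show "(\<Sum>\<alpha>\<in>index_set (n - 2) (2 * n). if i \<in> neither n \<alpha> \<and> \<alpha> \<union> {i, 2 * n - i + 1} = \<beta> then G \<alpha> else 0)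
      = (if i \<in> both n \<beta> then G (\<beta> - {i, 2 * n - i + 1}) else 0)" by simp
  qed simp
  also have "\<dots> = (\<Sum>i\<in>{1..n} \<inter> both n \<beta>. G (\<beta> - {i, 2 * n - i + 1}))"
    by (rule sum.inter_restrict[symmetric]) simp
  also have "{1..n} \<inter> both n \<beta> = both n \<beta>" using both_subset by blast
  finally show ?thesis .
qed

section \<open>Invertibility of a left factor from maximal rank\<close>

lemma invertible_mat_if_det_nonzero:
  assumes A: "(A :: 'a :: field mat) \<in> carrier_mat n n" and det: "det A \<noteq> 0"
  shows "invertible_mat A"
proof -
  obtain B where "B \<in> carrier_mat n n" "B * A = 1\<^sub>m n" "A * B = 1\<^sub>m n"
    using det_non_zero_imp_unit[OF A det, of "()"] by (auto simp: Units_def ring_mat_def)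
  then show ?thesis
    using A by (auto simp: invertible_mat_def inverts_mat_def intro!: exI[of _ B])
qed

text \<open>A singular P has a nonzero w in its left kernel. Such a w is orthogonal to all columns
  of \<open>P * B\<close>, which is impossible when n of them are linearly independent.\<close>

lemma (in vec_space) left_factor_invertible:
  assumes P: "P \<in> carrier_mat n n" and B: "B \<in> carrier_mat n m" and rank: "rank (P * B) = n"
  shows "invertible_mat P"
proof (rule ccontr)
  assume "\<not> invertible_mat P"
  then have "det (transpose_mat P) = 0"
    using invertible_mat_if_det_nonzero[OF P] det_transpose[OF P] by auto
  then obtain w where w: "w \<in> carrier_vec n" "w \<noteq> 0\<^sub>v n" "transpose_mat P *\<^sub>v w = 0\<^sub>v n"
    using det_0_iff_vec_prod_zero_field[of "transpose_mat P" n] P by auto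
  have PB: "P * B \<in> carrier_mat n m" using P B by simp
  have orth: "w \<bullet> h = 0" if h: "h \<in> set (cols (P * B))" for h
  proof -
    obtain j where j: "j < m" "h = col (P * B) j"
      using h PB by (metis carrier_matD(2) cols_length cols_nth in_set_conv_nth)
    have "h = P *\<^sub>v col B j" by (rule trans[OF j(2) col_mult2[OF P B j(1)]])
    then have "w \<bullet> h = (transpose_mat P *\<^sub>v w) \<bullet> col B j"
      using transpose_vec_mult_scalar[OF P _ w(1), of "col B j"] B j by simp
    then show ?thesis using w(3) B j by simp
  qed
  \<comment> \<open>The rank is the size of a maximal independent set of columns; n such columns
    form an invertible square matrix.\<close>
  obtain U where U: "maximal U (\<lambda>T. T \<subseteq> set (cols (P * B)) \<and> lin_indpt T)"
    using maximal_exists_superset[of "set (cols (P * B))" "\<lambda>T. T \<subseteq> set (cols (P * B)) \<and> lin_indpt T" "{}"]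
    by (auto simp: lin_dep_def)
  then have U': "U \<subseteq> set (cols (P * B))" "lin_indpt U" "card U = n"
    using rank_card_indpt[OF PB U] rank by (auto simp: maximal_def)
  obtain us where us: "set us = U" "distinct us"
    using finite_distinct_list finite_subset[OF U'(1)] by blast
  have len: "length us = n" using us U'(3) distinct_card by fastforce
  define A where "A = mat_of_cols n us"
  have us_carrier: "set us \<subseteq> carrier_vec n" using us U'(1) cols_dim[of "P * B"] P by auto
  have A: "A \<in> carrier_mat n n" "cols A = us"
    unfolding A_def using len us_carrier by (auto simp: cols_mat_of_cols)
  have "rank A = n" using lin_indpt_full_rank[OF A(1)] A(2) us U'(2) by simp
  then have "det (transpose_mat A) \<noteq> 0" using det_rank_iff[OF A(1)] det_transpose[OF A(1)] by simp
  moreover have "transpose_mat A *\<^sub>v w = 0\<^sub>v n"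
  proof (rule eq_vecI)
    fix i assume i: "i < dim_vec (0\<^sub>v n :: 'a vec)"
    then have "col A i \<in> set us" using A by (metis carrier_matD(2) cols_length cols_nth nth_mem index_zero_vec(2))
    then have "w \<bullet> col A i = 0" "col A i \<in> carrier_vec n" using orth us U'(1) us_carrier by auto
    then show "(transpose_mat A *\<^sub>v w) $ i = 0\<^sub>v n $ i"
      using i A w(1) comm_scalar_prod[of "col A i" n w] by simp
  qed (use A in simp)
  ultimately show False
    using det_0_iff_vec_prod_zero_field[of "transpose_mat A" n] A w by auto
qed

section \<open>Matrices annulling the rational points\<close>

context symplectic_space
begin

lemma plucker_vec_wedge:
  assumes "length v = n"
  shows "plucker_vec scale n e (wedge scale v)
    = vec ((2 * n) choose n) (\<lambda>b. minor (ordered n (subset_list n (2 * n) ! b)) v)"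
proof (rule eq_vecI)
  fix b assume "b < dim_vec (vec ((2 * n) choose n) (\<lambda>b. minor (ordered n (subset_list n (2 * n) ! b)) v))"
  then have "b < (2 * n) choose n" by simp
  then show "plucker_vec scale n e (wedge scale v) $ b
      = vec ((2 * n) choose n) (\<lambda>b. minor (ordered n (subset_list n (2 * n) ! b)) v) $ b"
    using nth_subset_list_mem[of b "2 * n" n]
    by (simp add: plucker_vec_def plucker_coords_wedge[OF assms] nth_subset_list)
qed (simp add: plucker_vec_def)

lemma mult_plucker_vec:
  assumes "H \<in> carrier_mat R ((2 * n) choose n)" "a < R" "length v = n"
  shows "(H *\<^sub>v plucker_vec scale n e (wedge scale v)) $ a
    = (\<Sum>b = 0..<(2 * n) choose n. H $$ (a, b) * minor (ordered n (subset_list n (2 * n) ! b)) v)"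
  using assms by (auto simp: plucker_vec_wedge scalar_prod_def intro!: sum.cong)

lemma B_LG_annuls:
  assumes "(2 :: 'a) \<noteq> 0" "n \<ge> 2"
  shows "annuls_rational_points scale n \<omega> e (B_LG n)"
  unfolding annuls_rational_points_def
proof
  fix w assume "w \<in> rational_points scale n \<omega>"
  then obtain v where v: "w = wedge scale v" "length v = n" "isotropic v"
    by (auto simp: rational_points_def isotropic_def)
  show "B_LG n *\<^sub>v plucker_vec scale n e w = 0\<^sub>v (dim_row (B_LG n :: 'a mat))"
  proof (rule eq_vecI)
    fix a assume "a < dim_vec (0\<^sub>v (dim_row (B_LG n :: 'a mat)) :: 'a vec)"
    then have a: "a < (2 * n) choose (n - 2)" by (simp add: B_LG_def)
    define \<alpha> where "\<alpha> = subset_list (n - 2) (2 * n) ! a"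
    have \<alpha>: "\<alpha> \<in> index_set (n - 2) (2 * n)" unfolding \<alpha>_def using a by (rule nth_subset_list_mem)
    have \<alpha>': "\<alpha> \<subseteq> {1..2 * n}" "card \<alpha> = n - 2" using \<alpha> by (auto simp: index_set_def)
    have "(B_LG n *\<^sub>v plucker_vec scale n e w) $ a
        = (\<Sum>b = 0..<(2 * n) choose n. B_LG n $$ (a, b) * minor (ordered n (subset_list n (2 * n) ! b)) v)"
      unfolding v(1) by (rule mult_plucker_vec[OF B_LG_carrier a v(2)])
    also have "\<dots> = (\<Sum>b = 0..<(2 * n) choose n. Pi_form n \<alpha> (\<lambda>\<gamma>. if \<gamma> = subset_list n (2 * n) ! b then 1 else 0)
        * minor (ordered n (subset_list n (2 * n) ! b)) v)"
      using a by (intro sum.cong) (auto simp: B_LG_entry \<alpha>_def)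
    also have "\<dots> = Pi_form n \<alpha> (\<lambda>\<beta>. minor (ordered n \<beta>) v)"
      by (rule trans[OF sum_subset_list[where f = "\<lambda>\<beta>. Pi_form n \<alpha> (\<lambda>\<gamma>. if \<gamma> = \<beta> then 1 else 0)
        * minor (ordered n \<beta>) v"] sum_Pi_form[OF assms(2) \<alpha>]])
    \<comment> \<open>The sum may run over all i: where the coefficient is 0, the pair repeats an
      index and the minor has two equal columns.\<close>
    also have "\<dots> = (\<Sum>i = 1..n. minor (i # (2 * n - i + 1) # ordered n \<alpha>) v)"
      unfolding Pi_form_def
    proof (rule sum.cong)
      fix i assume i: "i \<in> {1..n}"
      show "Pi_coeff n \<alpha> i * minor (ordered n (\<alpha> \<union> {i, 2 * n - i + 1})) v
          = minor (i # (2 * n - i + 1) # ordered n \<alpha>) v"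
      proof (cases "i \<in> neither n \<alpha>")
        case True
        then have "\<alpha> \<inter> pairs n (set [i]) = {}" by (auto simp: neither_def)
        moreover have "card \<alpha> + 2 * length [i] = n" using \<alpha>'(2) assms(2) by simp
        ultimately have "minor (ordered n (\<alpha> \<union> pairs n (set [i]))) v = minor (pair_list n [i] @ ordered n \<alpha>) v"
          using i \<alpha>'(1) by (intro skew_ordered[OF skew_minor]) auto
        then show ?thesis using True by (simp add: Pi_coeff_eq[OF assms(2) \<alpha> i])
      next
        case False
        then have "\<not> distinct (i # (2 * n - i + 1) # ordered n \<alpha>)"
          using i set_ordered[OF \<alpha>'(1)] by (auto simp: neither_def)
        moreover have "length (i # (2 * n - i + 1) # ordered n \<alpha>) = n"
          using length_ordered[OF \<alpha>'(1)] \<alpha>'(2) assms(2) by simp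
        ultimately show ?thesis
          using False by (simp add: Pi_coeff_eq[OF assms(2) \<alpha> i] minor_repeat)
      qed
    qed simp
    also have "\<dots> = 0"
      using v assms \<alpha>' by (intro minor_pair_sum_zero) (auto simp: length_ordered)
    finally show "(B_LG n *\<^sub>v plucker_vec scale n e w) $ a = 0\<^sub>v (dim_row (B_LG n :: 'a mat)) $ a"
      using a by (simp add: B_LG_def)
  qed simp
qed

text \<open>A row of H, paired with the minors, is an alternating form vanishing on isotropic
  tuples. The function G describing that form becomes the corresponding row of P.\<close>

lemma annuls_factor:
  assumes "n \<ge> 2" and f: "\<And>j. 2 * j \<le> n \<Longrightarrow> (of_nat (fact j) :: 'a) \<noteq> 0"
    and H: "H \<in> carrier_mat R ((2 * n) choose n)" and ann: "annuls_rational_points scale n \<omega> e H"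
  obtains P where "P \<in> carrier_mat R ((2 * n) choose (n - 2))" "H = P * B_LG n"
proof -
  let ?C = "(2 * n) choose n"
  define \<Phi> where "\<Phi> a v = (\<Sum>b = 0..<?C. H $$ (a, b) * minor (ordered n (subset_list n (2 * n) ! b)) v)" for a v
  have \<Phi>: "alternating_form scale n (\<Phi> a)" for a
    unfolding \<Phi>_def by (intro alternating_form_lincomb alternating_form_minor)
  have vanish: "\<Phi> a v = 0" if "a < R" "length v = n" "isotropic v" for a v
  proof (cases "distinct v \<and> independent (set v)")
    case True
    then have "wedge scale v \<in> rational_points scale n \<omega>"
      using that by (auto simp: rational_points_def isotropic_def)
    then have "H *\<^sub>v plucker_vec scale n e (wedge scale v) = 0\<^sub>v R"
      using ann H by (auto simp: annuls_rational_points_def)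
    then show ?thesis using mult_plucker_vec[OF H that(1,2)] that(1) by (simp add: \<Phi>_def)
  next
    case False
    then show ?thesis
      using alternating_form_not_distinct[OF \<Phi> that(2)] alternating_form_dependent[OF \<Phi> that(2)] by blast
  qed
  have "\<exists>G. \<forall>\<beta>\<in>index_set n (2 * n). \<Phi> a (map e (ordered n \<beta>)) = (\<Sum>i\<in>both n \<beta>. G (\<beta> - {i, 2 * n - i + 1}))"
    if "a < R" for a
    by (rule annihilator_form[OF \<Phi> vanish[OF that] f]) blast+
  then obtain G where G: "\<And>a \<beta>. a < R \<Longrightarrow> \<beta> \<in> index_set n (2 * n) \<Longrightarrow>
      \<Phi> a (map e (ordered n \<beta>)) = (\<Sum>i\<in>both n \<beta>. G a (\<beta> - {i, 2 * n - i + 1}))"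
    by metis
  define P where "P = mat R ((2 * n) choose (n - 2)) (\<lambda>(a, c). G a (subset_list (n - 2) (2 * n) ! c))"
  show ?thesis
  proof (rule that)
    show "P \<in> carrier_mat R ((2 * n) choose (n - 2))" by (simp add: P_def)
    show "H = P * B_LG n"
    proof (rule eq_matI)
      fix a b assume "a < dim_row (P * B_LG n)" "b < dim_col (P * B_LG n)"
      then have ab: "a < R" "b < ?C" by (auto simp: P_def B_LG_def)
      define \<beta> where "\<beta> = subset_list n (2 * n) ! b"
      have \<beta>: "\<beta> \<in> index_set n (2 * n)" unfolding \<beta>_def using ab(2) by (rule nth_subset_list_mem)
      have "(P * B_LG n) $$ (a, b) = (\<Sum>c = 0..<(2 * n) choose (n - 2). P $$ (a, c) * B_LG n $$ (c, b))"
        using ab by (simp add: P_def B_LG_def scalar_prod_def)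
      also have "\<dots> = (\<Sum>c = 0..<(2 * n) choose (n - 2).
          G a (subset_list (n - 2) (2 * n) ! c)
            * Pi_form n (subset_list (n - 2) (2 * n) ! c) (\<lambda>\<gamma>. if \<gamma> = \<beta> then 1 else 0))"
        using ab by (intro sum.cong) (auto simp: P_def B_LG_entry \<beta>_def)
      also have "\<dots> = (\<Sum>i\<in>both n \<beta>. G a (\<beta> - {i, 2 * n - i + 1}))"
        by (rule trans[OF sum_subset_list[where f = "\<lambda>\<alpha>. G a \<alpha> * Pi_form n \<alpha> (\<lambda>\<gamma>. if \<gamma> = \<beta> then 1 else 0)"]
          sum_Pi_form_transpose[OF assms(1) \<beta>]])
      also have "\<dots> = \<Phi> a (map e (ordered n \<beta>))" using G[OF ab(1) \<beta>] by simp
      \<comment> \<open>Minors are dual to the basis tuples, so the value of the row form at the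
        tuple of \<beta> is the matrix entry in column b.\<close>
      also have "\<dots> = (\<Sum>b' = 0..<?C. if b' = b then H $$ (a, b') else 0)"
        unfolding \<Phi>_def
      proof (rule sum.cong)
        fix b' assume "b' \<in> {0..<?C}"
        then have b': "b' < ?C" by simp
        have "\<beta> = subset_list n (2 * n) ! b' \<longleftrightarrow> b' = b"
          unfolding \<beta>_def using nth_eq_iff_index_eq[OF distinct_subset_list[of n "2 * n"], of b b'] ab(2) b' by auto
        then show "H $$ (a, b') * minor (ordered n (subset_list n (2 * n) ! b')) (map e (ordered n \<beta>))
            = (if b' = b then H $$ (a, b') else 0)"
          using minor_basis[OF \<beta> nth_subset_list_mem[OF b']] by simp
      qed simp
      also have "\<dots> = H $$ (a, b)" using ab(2) by simp
      finally show "H $$ (a, b) = (P * B_LG n) $$ (a, b)" by simp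
    qed (use H in \<open>auto simp: P_def B_LG_def\<close>)
  qed
qed

end

section \<open>Block structure\<close>


text \<open>With labels instead of positions, permuting rows and columns means reordering label
  lists, and forming blocks means concatenating them.\<close>

definition label_mat :: "('b \<Rightarrow> 'c \<Rightarrow> 'a) \<Rightarrow> 'b list \<Rightarrow> 'c list \<Rightarrow> 'a mat" where
  "label_mat f xs ys = mat (length xs) (length ys) (\<lambda>(a, b). f (xs ! a) (ys ! b))"

lemma label_mat_permutation:
  assumes "distinct xs" "distinct xs'" "set xs = set xs'" "distinct ys" "distinct ys'" "set ys = set ys'"
  shows "equal_up_to_permutation (label_mat f xs ys) (label_mat f xs' ys')"
proof -
  have "mset xs' = mset xs" "mset ys' = mset ys" using assms by (metis set_eq_iff_mset_eq_distinct)+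
  then obtain \<sigma> \<tau> where \<sigma>: "\<sigma> permutes {..<length xs}" "permute_list \<sigma> xs = xs'"
    and \<tau>: "\<tau> permutes {..<length ys}" "permute_list \<tau> ys = ys'"
    by (metis mset_eq_permutation)
  have len: "length xs' = length xs" "length ys' = length ys" using \<sigma>(2) \<tau>(2) by auto
  have nth: "xs' ! a = xs ! \<sigma> a" "\<sigma> a < length xs" if "a < length xs" for a
    using that permute_list_nth[OF \<sigma>(1) that] \<sigma>(2) permutes_in_image[OF \<sigma>(1), of a] by auto
  have nth': "ys' ! b = ys ! \<tau> b" "\<tau> b < length ys" if "b < length ys" for b
    using that permute_list_nth[OF \<tau>(1) that] \<tau>(2) permutes_in_image[OF \<tau>(1), of b] by auto
  have "label_mat f xs' ys' = mat (length xs) (length ys) (\<lambda>(a, b). label_mat f xs ys $$ (\<sigma> a, \<tau> b))"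
    by (rule eq_matI) (auto simp: label_mat_def len nth nth')
  then show ?thesis
    unfolding equal_up_to_permutation_def using \<sigma>(1) \<tau>(1) by (auto simp: label_mat_def)
qed

lemma label_mat_append:
  assumes "\<And>x y. x \<in> set xs \<Longrightarrow> y \<in> set ys' \<Longrightarrow> f x y = 0"
    and "\<And>x y. x \<in> set xs' \<Longrightarrow> y \<in> set ys \<Longrightarrow> f x y = 0"
  shows "label_mat f (xs @ xs') (ys @ ys') = four_block_mat (label_mat f xs ys)
    (0\<^sub>m (length xs) (length ys')) (0\<^sub>m (length xs') (length ys)) (label_mat f xs' ys')"
  by (rule eq_matI) (auto simp: label_mat_def nth_append assms)

lemma diag_block_label_mat:
  assumes "distinct bs"
    and "\<And>b b' x y. b \<in> set bs \<Longrightarrow> b' \<in> set bs \<Longrightarrow> b \<noteq> b' \<Longrightarrow> x \<in> set (r b) \<Longrightarrow> y \<in> set (c b') \<Longrightarrow> f x y = 0"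
    and "\<And>b x y. b \<in> set bs \<Longrightarrow> x \<in> set (r b) \<Longrightarrow> y \<in> set zs \<Longrightarrow> f x y = 0"
  shows "diag_block_mat (map (\<lambda>b. label_mat f (r b) (c b)) bs @ [0\<^sub>m 0 (length zs)])
    = label_mat f (concat (map r bs)) (concat (map c bs) @ zs)"
  using assms
proof (induction bs)
  case Nil
  then show ?case by (auto simp: label_mat_def)
next
  case (Cons b bs)
  have "diag_block_mat (map (\<lambda>b. label_mat f (r b) (c b)) bs @ [0\<^sub>m 0 (length zs)])
    = label_mat f (concat (map r bs)) (concat (map c bs) @ zs)"
    by (rule Cons.IH) (use Cons.prems in \<open>auto, blast+\<close>)
  moreover have "label_mat f (r b @ concat (map r bs)) (c b @ (concat (map c bs) @ zs))
    = four_block_mat (label_mat f (r b) (c b)) (0\<^sub>m (length (r b)) (length (concat (map c bs) @ zs)))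
      (0\<^sub>m (length (concat (map r bs))) (length (c b))) (label_mat f (concat (map r bs)) (concat (map c bs) @ zs))"
  proof (rule label_mat_append)
    fix x y assume "x \<in> set (r b)" "y \<in> set (concat (map c bs) @ zs)"
    then show "f x y = 0" using Cons.prems(1) Cons.prems(2)[of b _ x y] Cons.prems(3)[of b x y] by auto
  next
    fix x y assume "x \<in> set (concat (map r bs))" "y \<in> set (c b)"
    then show "f x y = 0" using Cons.prems(1) Cons.prems(2)[of _ b x y] by auto
  qed
  ultimately show ?case by (simp add: Let_def label_mat_def)
qed

lemma distinct_concat_map:
  assumes "distinct bs" "\<And>b. b \<in> set bs \<Longrightarrow> distinct (r b)"
    and "\<And>b b'. b \<in> set bs \<Longrightarrow> b' \<in> set bs \<Longrightarrow> b \<noteq> b' \<Longrightarrow> set (r b) \<inter> set (r b') = {}"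
  shows "distinct (concat (map r bs))"
  using assms
proof (induction bs)
  case (Cons b bs)
  have "distinct (concat (map r bs))" by (rule Cons.IH) (use Cons.prems in simp_all)
  moreover have "set (r b) \<inter> set (r b') = {}" if "b' \<in> set bs" for b'
    using Cons.prems(1) that by (intro Cons.prems(3)) auto
  then have "set (r b) \<inter> set (concat (map r bs)) = {}" by (simp add: Int_UN_distrib)
  ultimately show ?case using Cons.prems(2) by simp
qed simp

definition pair_incidence :: "nat \<Rightarrow> nat set \<Rightarrow> nat set \<Rightarrow> 'a::zero_neq_one" where
  "pair_incidence n \<alpha> \<beta> = (if \<exists>i\<in>neither n \<alpha>. \<alpha> \<union> {i, 2 * n - i + 1} = \<beta> then 1 else 0)"

text \<open>Different free indices i enlarge \<alpha> to different sets, so at most one term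
  contributes and the entry is 0 or 1.\<close>

lemma Pi_form_indicator:
  assumes "n \<ge> 2" "\<alpha> \<in> index_set (n - 2) (2 * n)"
  shows "Pi_form n \<alpha> (\<lambda>\<gamma>. if \<gamma> = \<beta> then 1 else 0) = pair_incidence n \<alpha> \<beta>"
proof (cases "\<exists>i\<in>neither n \<alpha>. \<alpha> \<union> {i, 2 * n - i + 1} = \<beta>")
  case True
  then obtain i where i: "i \<in> neither n \<alpha>" "\<alpha> \<union> {i, 2 * n - i + 1} = \<beta>" by blast
  have "\<alpha> \<union> {j, 2 * n - j + 1} = \<beta> \<longleftrightarrow> j = i" if "j \<in> neither n \<alpha>" for j
  proof
    assume "\<alpha> \<union> {j, 2 * n - j + 1} = \<beta>"
    then have "j \<in> \<alpha> \<union> {i, 2 * n - i + 1}" using i(2) by blast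
    then show "j = i" using that i(1) by (auto simp: neither_def)
  qed (use i in simp)
  then have "Pi_form n \<alpha> (\<lambda>\<gamma>. if \<gamma> = \<beta> then 1 else 0) = (\<Sum>j\<in>neither n \<alpha>. if j = i then 1 else 0)"
    unfolding Pi_form_eq[OF assms] by (intro sum.cong) auto
  also have "\<dots> = 1" using i(1) finite_subset[OF neither_subset[of n \<alpha>]] by simp
  finally show ?thesis using True by (simp add: pair_incidence_def)
next
  case False
  then show ?thesis unfolding Pi_form_eq[OF assms] pair_incidence_def by (auto intro!: sum.neutral)
qed

lemma B_LG_label_mat:
  "n \<ge> 2 \<Longrightarrow> B_LG n = label_mat (pair_incidence n) (subset_list (n - 2) (2 * n)) (subset_list n (2 * n))"
  by (rule eq_matI)
    (auto simp: label_mat_def B_LG_entry Pi_form_indicator nth_subset_list_mem B_LG_def[THEN arg_cong[where f = dim_row]]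
      B_LG_def[THEN arg_cong[where f = dim_col]])

text \<open>Adding a pair enlarges T and leaves S alone, while both can be read off from the union.
  Hence different S never interact, and a fixed S leaves only the covering relation between the sets
  T.\<close>

lemma pair_incidence_blocks:
  assumes S: "both n S = {}" "both n S' = {}" and T: "T \<subseteq> neither n S" "T' \<subseteq> neither n S'"
  shows "pair_incidence n (S \<union> pairs n T) (S' \<union> pairs n T')
    = (if S = S' \<and> (\<exists>i. i \<notin> T \<and> T' = insert i T) then 1 else 0)"
proof -
  have Tn: "T \<subseteq> {1..n}" "T' \<subseteq> {1..n}" using T neither_subset by blast+
  have disj: "S \<inter> pairs n U = {}" if "U \<subseteq> neither n S" for U
    using disjoint_pairs_iff[of U n S] that neither_subset by blast
  have disj': "S' \<inter> pairs n T' = {}" using disjoint_pairs_iff[OF Tn(2)] T(2) by blast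
  have "i \<in> neither n (S \<union> pairs n T) \<longleftrightarrow> i \<in> neither n S - T" for i
    using mem_pairs_iff[OF Tn(1), of i] by (auto simp: neither_def)
  moreover have "(S \<union> pairs n T) \<union> {i, 2 * n - i + 1} = S' \<union> pairs n T' \<longleftrightarrow> S = S' \<and> T' = insert i T"
    if i: "i \<in> neither n S - T" for i
  proof -
    have U: "insert i T \<subseteq> neither n S" "insert i T \<subseteq> {1..n}" using i T(1) neither_subset by blast+
    have "(S \<union> pairs n T) \<union> {i, 2 * n - i + 1} = S \<union> pairs n (insert i T)" by auto
    moreover have "S \<union> pairs n (insert i T) = S' \<union> pairs n T' \<longleftrightarrow> S = S' \<and> T' = insert i T"
      using both_union_pairs[OF S(1) disj[OF U(1)] U(2)] both_union_pairs[OF S(2) disj' Tn(2)] by metis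
    ultimately show ?thesis by simp
  qed
  ultimately have "(\<exists>i\<in>neither n (S \<union> pairs n T). (S \<union> pairs n T) \<union> {i, 2 * n - i + 1} = S' \<union> pairs n T')
      \<longleftrightarrow> S = S' \<and> (\<exists>i\<in>neither n S - T. T' = insert i T)" by blast
  also have "\<dots> \<longleftrightarrow> S = S' \<and> (\<exists>i. i \<notin> T \<and> T' = insert i T)" using T(2) by blast
  finally show ?thesis by (simp add: pair_incidence_def)
qed

text \<open>The increasing enumeration of the free indices, shifted because elements count from 1
  and list positions from 0. It transports the lexicographic numbering of subsets to the block, so
  that the block equals \<open>L_mat\<close> entry by entry.\<close>

definition block_index :: "nat \<Rightarrow> nat set \<Rightarrow> nat \<Rightarrow> nat" where
  "block_index n S i = sorted_list_of_set (neither n S) ! (i - 1)"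

definition block_labels :: "nat \<Rightarrow> nat \<Rightarrow> nat set \<Rightarrow> nat set list" where
  "block_labels n l S = map (\<lambda>\<gamma>. S \<union> pairs n (block_index n S ` \<gamma>)) (subset_list l (card (neither n S)))"

lemma block_index_bij: "bij_betw (block_index n S) {1..card (neither n S)} (neither n S)"
proof -
  have fin: "finite (neither n S)" by (rule finite_subset[OF neither_subset]) simp
  have "bij_betw ((!) (sorted_list_of_set (neither n S))) {..<card (neither n S)} (neither n S)"
    using fin by (intro bij_betw_nth) auto
  moreover have "bij_betw (\<lambda>i. i - 1) {1..card (neither n S)} {..<card (neither n S)}"
    by (rule bij_betw_byWitness[of _ Suc]) auto
  ultimately have "bij_betw ((!) (sorted_list_of_set (neither n S)) \<circ> (\<lambda>i. i - 1)) {1..card (neither n S)} (neither n S)"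
    by (rule bij_betw_trans[rotated])
  then show ?thesis by (simp add: block_index_def[abs_def] comp_def)
qed

lemma block_index_image:
  "(`) (block_index n S) ` index_set l (card (neither n S)) = {T. T \<subseteq> neither n S \<and> card T = l}"
proof (intro equalityI subsetI)
  fix T assume "T \<in> (`) (block_index n S) ` index_set l (card (neither n S))"
  then obtain \<gamma> where \<gamma>: "\<gamma> \<subseteq> {1..card (neither n S)}" "card \<gamma> = l" "T = block_index n S ` \<gamma>"
    by (auto simp: index_set_def)
  have "inj_on (block_index n S) \<gamma>" using block_index_bij \<gamma>(1) by (metis bij_betw_def inj_on_subset)
  moreover have "T \<subseteq> neither n S"
    unfolding \<gamma>(3) using image_mono[OF \<gamma>(1)] bij_betw_imp_surj_on[OF block_index_bij] by metis
  ultimately show "T \<in> {T. T \<subseteq> neither n S \<and> card T = l}"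
    using \<gamma> by (simp add: card_image)
next
  fix T assume T: "T \<in> {T. T \<subseteq> neither n S \<and> card T = l}"
  then obtain \<gamma> where \<gamma>: "\<gamma> \<subseteq> {1..card (neither n S)}" "T = block_index n S ` \<gamma>"
    using bij_betw_imp_surj_on[OF block_index_bij, of n S] by (metis (no_types, lifting) mem_Collect_eq subset_imageE)
  have "inj_on (block_index n S) \<gamma>" using block_index_bij \<gamma>(1) by (metis bij_betw_def inj_on_subset)
  then have "card \<gamma> = l" using T \<gamma>(2) by (simp add: card_image)
  then show "T \<in> (`) (block_index n S) ` index_set l (card (neither n S))"
    using \<gamma> by (auto simp: index_set_def)
qed

lemma block_index_imageD:
  assumes "\<gamma> \<in> index_set l (card (neither n S))"
  shows "block_index n S ` \<gamma> \<subseteq> neither n S" "card (block_index n S ` \<gamma>) = l"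
proof -
  have "block_index n S ` \<gamma> \<in> {T. T \<subseteq> neither n S \<and> card T = l}"
    unfolding block_index_image[symmetric] by (rule imageI[OF assms])
  then show "block_index n S ` \<gamma> \<subseteq> neither n S" "card (block_index n S ` \<gamma>) = l" by auto
qed

lemma set_block_labels:
  "set (block_labels n l S) = {S \<union> pairs n T |T. T \<subseteq> neither n S \<and> card T = l}"
proof -
  have "set (block_labels n l S)
      = (\<lambda>T. S \<union> pairs n T) ` (`) (block_index n S) ` index_set l (card (neither n S))"
    by (simp add: block_labels_def image_image)
  also have "\<dots> = {S \<union> pairs n T |T. T \<subseteq> neither n S \<and> card T = l}"
    unfolding block_index_image by auto
  finally show ?thesis .
qed

lemma both_singles_neither:
  assumes "both n S = {}" "T \<subseteq> neither n S"
  shows "both n (S \<union> pairs n T) = T" "singles n (S \<union> pairs n T) = S"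
proof -
  have T: "T \<subseteq> {1..n}" using assms(2) neither_subset by blast
  show "both n (S \<union> pairs n T) = T" "singles n (S \<union> pairs n T) = S"
    by (rule both_union_pairs[OF assms(1) _ T]; use disjoint_pairs_iff[OF T] assms(2) in blast)+
qed

lemma distinct_block_labels:
  assumes "both n S = {}"
  shows "distinct (block_labels n l S)"
proof -
  have "inj_on (\<lambda>\<gamma>. S \<union> pairs n (block_index n S ` \<gamma>)) (index_set l (card (neither n S)))"
  proof (rule inj_onI)
    fix \<gamma> \<delta> assume \<gamma>: "\<gamma> \<in> index_set l (card (neither n S))" and \<delta>: "\<delta> \<in> index_set l (card (neither n S))"
      and eq: "S \<union> pairs n (block_index n S ` \<gamma>) = S \<union> pairs n (block_index n S ` \<delta>)"
    have "block_index n S ` \<gamma> \<subseteq> neither n S" "block_index n S ` \<delta> \<subseteq> neither n S"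
      using \<gamma> \<delta> by (simp_all add: block_index_imageD)
    then have "block_index n S ` \<gamma> = block_index n S ` \<delta>"
      using both_singles_neither(1)[OF assms] eq by metis
    then show "\<gamma> = \<delta>"
      using inj_on_image_eq_iff[OF bij_betw_imp_inj_on[OF block_index_bij]] \<gamma> \<delta>
      by (auto simp: index_set_def)
  qed
  then show ?thesis by (simp add: block_labels_def distinct_map)
qed

lemma L_mat_label_mat:
  "j \<ge> 1 \<Longrightarrow> L_mat (Suc j)
    = label_mat (\<lambda>\<gamma> \<delta>. if \<gamma> \<subseteq> \<delta> then 1 else 0) (subset_list (j - 1) (2 * j)) (subset_list j (2 * j))"
proof -
  assume j: "j \<ge> 1"
  have "2 * Suc j - 2 = 2 * j" "(2 * j - 2) div 2 = j - 1" "2 * j div 2 = j" using j by auto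
  then show ?thesis
    by (intro eq_matI) (auto simp: L_mat_def Let_def label_mat_def nth_subset_list simp del: mult_Suc_right)
qed

lemma L_mat_block:
  assumes S: "both n S = {}" and j: "card (neither n S) = 2 * j" "j \<ge> 1"
  shows "L_mat (Suc j) = label_mat (pair_incidence n) (block_labels n (j - 1) S) (block_labels n j S)"
proof (rule eq_matI)
  fix a b
  assume "a < dim_row (label_mat (pair_incidence n) (block_labels n (j - 1) S) (block_labels n j S))"
    "b < dim_col (label_mat (pair_incidence n) (block_labels n (j - 1) S) (block_labels n j S))"
  then have ab: "a < (2 * j) choose (j - 1)" "b < (2 * j) choose j"
    by (simp_all add: label_mat_def block_labels_def j)
  define \<gamma> \<delta> where "\<gamma> = subset_list (j - 1) (2 * j) ! a" and "\<delta> = subset_list j (2 * j) ! b"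
  have \<gamma>: "\<gamma> \<subseteq> {1..2 * j}" "card \<gamma> = j - 1" and \<delta>: "\<delta> \<subseteq> {1..2 * j}" "card \<delta> = j"
    using nth_subset_list_mem[OF ab(1)] nth_subset_list_mem[OF ab(2)] by (auto simp: \<gamma>_def \<delta>_def index_set_def)
  have inj: "inj_on (block_index n S) {1..2 * j}"
    using bij_betw_imp_inj_on[OF block_index_bij, of n S] j by simp
  define T T' where "T = block_index n S ` \<gamma>" and "T' = block_index n S ` \<delta>"
  have T: "T \<subseteq> neither n S" "card T = j - 1" "T' \<subseteq> neither n S" "card T' = j"
  proof -
    have "\<gamma> \<in> index_set (j - 1) (card (neither n S))" "\<delta> \<in> index_set j (card (neither n S))"
      using \<gamma> \<delta> j by (auto simp: index_set_def)
    then show "T \<subseteq> neither n S" "card T = j - 1" "T' \<subseteq> neither n S" "card T' = j"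
      unfolding T_def T'_def by (simp_all add: block_index_imageD)
  qed
  \<comment> \<open>With sizes j - 1 and j, inclusion is the same as adding a single
    element.\<close>
  have "(\<exists>i. i \<notin> T \<and> T' = insert i T) \<longleftrightarrow> T \<subseteq> T'"
  proof
    assume "T \<subseteq> T'"
    have fin: "finite T" "finite T'" using T finite_subset neither_subset by (meson finite_atLeastAtMost)+
    have "card (T' - T) = 1" using card_Diff_subset[OF fin(1) \<open>T \<subseteq> T'\<close>] T j(2) by simp
    then obtain i where "T' - T = {i}" by (auto simp: card_1_singleton_iff)
    then show "\<exists>i. i \<notin> T \<and> T' = insert i T" using \<open>T \<subseteq> T'\<close> by blast
  qed blast
  also have "\<dots> \<longleftrightarrow> \<gamma> \<subseteq> \<delta>"
  proof -
    have "block_index n S x \<in> T' \<longleftrightarrow> x \<in> \<delta>" if "x \<in> \<gamma>" for x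
      unfolding T'_def by (rule inj_on_image_mem_iff[OF inj _ \<delta>(1)]) (use \<gamma>(1) that in blast)
    then show ?thesis unfolding T_def image_subset_iff by blast
  qed
  finally have "pair_incidence n (S \<union> pairs n T) (S \<union> pairs n T') = (if \<gamma> \<subseteq> \<delta> then 1 else 0 :: 'a)"
    using pair_incidence_blocks[OF S S T(1,3)] by simp
  then show "(L_mat (Suc j) :: 'a mat) $$ (a, b)
      = label_mat (pair_incidence n) (block_labels n (j - 1) S) (block_labels n j S) $$ (a, b)"
    unfolding L_mat_label_mat[OF j(2)] using ab
    by (simp add: label_mat_def block_labels_def j \<gamma>_def \<delta>_def T_def T'_def)
qed (simp_all add: L_mat_label_mat[OF j(2)] label_mat_def block_labels_def j)

lemma B_LG_block_diagonal:
  assumes "n \<ge> 2"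
  shows "\<exists>ks z. set ks = {2..(n + 2) div 2} \<and> equal_up_to_permutation (B_LG n :: 'a::field mat) (direct_sum_of_L ks z)"
proof -
  \<comment> \<open>One block for each S with room for at least one pair. Without that condition S
    would have n elements and be its own zero column; such columns are collected in
    \<open>zs\<close>.\<close>
  define \<S> where "\<S> = {S. S \<subseteq> {1..2 * n} \<and> both n S = {} \<and> (\<exists>j\<ge>1. card S + 2 * j = n)}"
  define half where "half S = (n - card S) div 2" for S :: "nat set"
  have \<S>: "both n S = {}" "S \<subseteq> {1..2 * n}" "card S + 2 * half S = n" "half S \<ge> 1"
    "card (neither n S) = 2 * half S" if "S \<in> \<S>" for S
  proof -
    show *: "both n S = {}" "S \<subseteq> {1..2 * n}" "card S + 2 * half S = n" "half S \<ge> 1"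
      using that by (auto simp: \<S>_def half_def)
    show "card (neither n S) = 2 * half S" using card_neither[OF *(1,2)] *(3) by simp
  qed
  have "finite \<S>" by (rule finite_subset[of _ "Pow {1..2 * n}"]) (auto simp: \<S>_def)
  then obtain bs where bs: "set bs = \<S>" "distinct bs" using finite_distinct_list by blast
  define rows cols where "rows S = block_labels n (half S - 1) S" and "cols S = block_labels n (half S) S" for S
  define zs where "zs = filter (\<lambda>\<beta>. both n \<beta> = {}) (subset_list n (2 * n))"
  define ks where "ks = map (\<lambda>S. Suc (half S)) bs"
  have labels: "\<exists>T. x = S \<union> pairs n T \<and> T \<subseteq> neither n S \<and> card T = l"
    if "x \<in> set (block_labels n l S)" for x l S
    using that by (auto simp: set_block_labels)
  have sing: "singles n x = S" if "S \<in> \<S>" "x \<in> set (block_labels n l S)" for S x l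
    using labels[OF that(2)] both_singles_neither(2) \<S>(1)[OF that(1)] by blast
  have card_label: "card (S \<union> pairs n T) = card S + 2 * card T" "S \<union> pairs n T \<subseteq> {1..2 * n}"
    if "S \<in> \<S>" "T \<subseteq> neither n S" for S T
  proof -
    have "T \<subseteq> {1..n}" using that(2) neither_subset by blast
    then show sub: "S \<union> pairs n T \<subseteq> {1..2 * n}" using \<S>(2)[OF that(1)] pairs_subset by blast
    show "card (S \<union> pairs n T) = card S + 2 * card T"
      using card_singles[OF sub] both_singles_neither[OF \<S>(1)[OF that(1)] that(2)] by simp
  qed
  \<comment> \<open>Here d = 1 treats the row labels and d = 0 the column labels; for columns the
    condition on \<open>both\<close> excludes the zero columns.\<close>
  have decomp: "\<exists>S\<in>\<S>. \<exists>T. x = S \<union> pairs n T \<and> T \<subseteq> neither n S \<and> card T + d = half S"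
    if x: "x \<in> index_set (n - 2 * d) (2 * n)" and d: "card (both n x) + d \<ge> 1" "2 * d \<le> n" for x d
  proof -
    have x': "x \<subseteq> {1..2 * n}" "card x = n - 2 * d" using x by (auto simp: index_set_def)
    have c: "card (singles n x) + 2 * (card (both n x) + d) = n" using card_singles[OF x'(1)] x'(2) d(2) by simp
    have "singles n x \<in> \<S>"
      unfolding \<S>_def using c d(1) both_singles[of n x] singles_subset[of n x] x'(1) by blast
    moreover have "half (singles n x) = card (both n x) + d" using c by (simp add: half_def)
    ultimately show ?thesis
      using singles_un_both[of n x] both_subset_neither_singles[of n x] by metis
  qed
  have "set ks = {2..(n + 2) div 2}"
  proof (intro equalityI subsetI)
    fix k assume "k \<in> set ks"
    then obtain S where "S \<in> \<S>" "k = Suc (half S)" using bs by (auto simp: ks_def)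
    then show "k \<in> {2..(n + 2) div 2}" using \<S>(3,4)[of S] by auto
  next
    fix k assume k: "k \<in> {2..(n + 2) div 2}"
    \<comment> \<open>Indices up to n contain no complete pair, so an initial segment of the right
      length witnesses that blocks of size parameter k occur.\<close>
    define S where "S = {1..n - 2 * (k - 1)}"
    have "S \<subseteq> {1..2 * n}" by (auto simp: S_def)
    moreover have "both n S = {}" by (auto simp: both_def S_def)
    moreover have c: "card S + 2 * (k - 1) = n" "k - 1 \<ge> 1" using k by (auto simp: S_def)
    ultimately have "S \<in> \<S>" unfolding \<S>_def by blast
    moreover have "k = Suc (half S)" using c by (simp add: half_def)
    ultimately show "k \<in> set ks" using bs by (auto simp: ks_def)
  qed
  moreover have "equal_up_to_permutation (B_LG n :: 'a mat) (direct_sum_of_L ks (length zs))"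
  proof -
    have "direct_sum_of_L ks (length zs)
        = diag_block_mat (map (\<lambda>S. label_mat (pair_incidence n :: _ \<Rightarrow> _ \<Rightarrow> 'a) (rows S) (cols S)) bs @ [0\<^sub>m 0 (length zs)])"
      unfolding direct_sum_of_L_def ks_def map_map comp_def rows_def cols_def
      using L_mat_block[where 'a = 'a] \<S> bs(1) by (intro arg_cong[where f = diag_block_mat] arg_cong2[where f = "(@)"] map_cong) auto
    also have "\<dots> = label_mat (pair_incidence n) (concat (map rows bs)) (concat (map cols bs) @ zs)"
    proof (rule diag_block_label_mat[OF bs(2)])
      fix S S' x y assume *: "S \<in> set bs" "S' \<in> set bs" "S \<noteq> S'" "x \<in> set (rows S)" "y \<in> set (cols S')"
      obtain T where T: "x = S \<union> pairs n T" "T \<subseteq> neither n S" using labels *(4) unfolding rows_def by blast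
      obtain T' where T': "y = S' \<union> pairs n T'" "T' \<subseteq> neither n S'" using labels *(5) unfolding cols_def by blast
      show "pair_incidence n x y = (0 :: 'a)"
        using pair_incidence_blocks[of n S S' T T'] \<S>(1) bs(1) * T T' by auto
    next
      fix S x y assume *: "S \<in> set bs" "x \<in> set (rows S)" "y \<in> set zs"
      obtain T where T: "x = S \<union> pairs n T" "T \<subseteq> neither n S" using labels *(2) unfolding rows_def by blast
      \<comment> \<open>Such a y is its own S with empty T, and the empty set does not arise by
        inserting an element.\<close>
      have "both n y = {}" using *(3) by (simp add: zs_def)
      then show "pair_incidence n x y = (0 :: 'a)"
        using pair_incidence_blocks[of n S y T "{}"] \<S>(1) bs(1) *(1) T by auto
    qed
    finally have sum: "direct_sum_of_L ks (length zs)
      = label_mat (pair_incidence n :: _ \<Rightarrow> _ \<Rightarrow> 'a) (concat (map rows bs)) (concat (map cols bs) @ zs)" .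
    have disj: "set (block_labels n l S) \<inter> set (block_labels n l' S') = {}"
      if "S \<in> set bs" "S' \<in> set bs" "S \<noteq> S'" for S S' l l'
      using sing that bs(1) by blast
    have distinct_labels: "distinct (concat (map (\<lambda>S. block_labels n (l S) S) bs))" for l
      using bs \<S>(1) disj by (intro distinct_concat_map distinct_block_labels) auto
    have both_cols: "both n y \<noteq> {}" if y: "S \<in> \<S>" "y \<in> set (cols S)" for S y
    proof -
      obtain T where T: "y = S \<union> pairs n T" "T \<subseteq> neither n S" "card T = half S"
        using labels y(2) unfolding cols_def by blast
      have "both n y = T" using both_singles_neither(1)[OF \<S>(1)[OF y(1)] T(2)] T(1) by simp
      then show ?thesis using T(3) \<S>(4)[OF y(1)] by auto
    qed
    show ?thesis
      unfolding sum B_LG_label_mat[OF assms]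
    proof (rule label_mat_permutation)
      show "distinct (concat (map rows bs))" unfolding rows_def by (rule distinct_labels)
      show "distinct (concat (map cols bs) @ zs)"
        using distinct_labels[of half] both_cols bs(1) by (auto simp: zs_def cols_def[abs_def])
      show "set (subset_list (n - 2) (2 * n)) = set (concat (map rows bs))"
      proof (intro equalityI subsetI)
        fix x assume "x \<in> set (subset_list (n - 2) (2 * n))"
        then have "\<exists>S\<in>\<S>. \<exists>T. x = S \<union> pairs n T \<and> T \<subseteq> neither n S \<and> card T + 1 = half S"
          using decomp[of x 1] assms by simp
        then obtain S T where "S \<in> \<S>" "x = S \<union> pairs n T" "T \<subseteq> neither n S" "card T = half S - 1" by force
        then show "x \<in> set (concat (map rows bs))" using bs(1) by (auto simp: rows_def set_block_labels)
      next
        fix x assume "x \<in> set (concat (map rows bs))"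
        then obtain S where S: "S \<in> \<S>" "x \<in> set (rows S)" using bs(1) by auto
        obtain T where T: "x = S \<union> pairs n T" "T \<subseteq> neither n S" "card T = half S - 1"
          using labels S(2) unfolding rows_def by blast
        have "card x = n - 2" using card_label(1)[OF S(1) T(2)] T(1,3) \<S>(3,4)[OF S(1)] by simp
        then show "x \<in> set (subset_list (n - 2) (2 * n))"
          using card_label(2)[OF S(1) T(2)] T(1) by (simp add: index_set_def)
      qed
      show "set (subset_list n (2 * n)) = set (concat (map cols bs) @ zs)"
      proof (intro equalityI subsetI)
        fix x assume x: "x \<in> set (subset_list n (2 * n))"
        show "x \<in> set (concat (map cols bs) @ zs)"
        proof (cases "both n x = {}")
          case True
          then show ?thesis using x by (simp add: zs_def)
        next
          case False
          then have "card (both n x) + 0 \<ge> 1"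
            using finite_subset[OF both_subset[of n x]] by (simp add: Suc_le_eq card_gt_0_iff)
          then obtain S T where "S \<in> \<S>" "x = S \<union> pairs n T" "T \<subseteq> neither n S" "card T = half S"
            using decomp[of x 0] x by auto
          then show ?thesis using bs(1) by (auto simp: cols_def set_block_labels)
        qed
      next
        fix x assume "x \<in> set (concat (map cols bs) @ zs)"
        then consider S where "S \<in> \<S>" "x \<in> set (cols S)" | "x \<in> set zs" using bs(1) by auto
        then show "x \<in> set (subset_list n (2 * n))"
        proof cases
          case (1 S)
          obtain T where T: "x = S \<union> pairs n T" "T \<subseteq> neither n S" "card T = half S"
            using labels 1(2) unfolding cols_def by blast
          have "card x = n" using card_label(1)[OF 1(1) T(2)] T(1,3) \<S>(3)[OF 1(1)] by simp
          then show ?thesis using card_label(2)[OF 1(1) T(2)] T(1) by (simp add: index_set_def)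
        qed (simp add: zs_def)
      qed
    qed simp_all
  qed
  ultimately show ?thesis by blast
qed

section \<open>The characteristic bound and the conclusion\<close>

lemma of_nat_fact_nonzero:
  assumes "CHAR('a::field) = 0 \<or> j < CHAR('a)"
  shows "(of_nat (fact j) :: 'a) \<noteq> 0"
proof (cases "CHAR('a) = 0")
  case True
  then show ?thesis by (simp add: of_nat_eq_0_iff_char_dvd del: of_nat_fact)
next
  case False
  then have "prime CHAR('a)" using prime_CHAR_semidom[where ?'a = 'a] by simp
  then show ?thesis using assms False by (simp add: of_nat_eq_0_iff_char_dvd prime_dvd_fact_iff del: of_nat_fact)
qed

theorem theorem7p3:
  fixes scale :: "'a::field \<Rightarrow> 'e::ab_group_add \<Rightarrow> 'e"
    and \<omega> :: "'e \<Rightarrow> 'e \<Rightarrow> 'a"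
    and e :: "nat \<Rightarrow> 'e"
    and n r :: nat
  assumes "n \<ge> 4"
    and "r = (n + 2) div 2"
    and "CHAR('a) = 0 \<or> CHAR('a) \<ge> r"
    and "symplectic_space scale n \<omega> e"
  shows "(\<exists>ks z. set ks = {2..r} \<and>
           equal_up_to_permutation (B_LG n :: 'a mat) (direct_sum_of_L ks z)) \<and>
         annuls_rational_points scale n \<omega> e (B_LG n) \<and>
         (\<forall>H \<in> carrier_mat ((2 * n) choose (n - 2)) ((2 * n) choose n).
           vec_space.rank ((2 * n) choose (n - 2)) H = (2 * n) choose (n - 2) \<longrightarrow>
           annuls_rational_points scale n \<omega> e H \<longrightarrow>
           (\<exists>P \<in> carrier_mat ((2 * n) choose (n - 2)) ((2 * n) choose (n - 2)).
             invertible_mat P \<and> H = P * B_LG n))"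
proof (intro conjI ballI impI)
  interpret symplectic_space scale n \<omega> e by (rule assms(4))
  \<comment> \<open>From 2j \<le> n follows j \<le> r - 1, so j lies below a positive
    characteristic.\<close>
  have fact: "(of_nat (fact j) :: 'a) \<noteq> 0" if "2 * j \<le> n" for j
    using that assms(2,3) by (intro of_nat_fact_nonzero) auto
  show "\<exists>ks z. set ks = {2..r} \<and> equal_up_to_permutation (B_LG n :: 'a mat) (direct_sum_of_L ks z)"
    unfolding assms(2) using assms(1) by (intro B_LG_block_diagonal) simp
  \<comment> \<open>Since n \<ge> 4, the case j = 2 is available and excludes characteristic 2,
    where the sign argument for minors would fail.\<close>
  have "(2 :: 'a) \<noteq> 0" using fact[of 2] assms(1) by (simp add: fact_numeral)
  then show "annuls_rational_points scale n \<omega> e (B_LG n)"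
    using assms(1) by (intro B_LG_annuls) auto
  fix H :: "'a mat"
  let ?R = "(2 * n) choose (n - 2)"
  assume H: "H \<in> carrier_mat ?R ((2 * n) choose n)" "vec_space.rank ?R H = ?R"
    "annuls_rational_points scale n \<omega> e H"
  obtain P where P: "P \<in> carrier_mat ?R ?R" "H = P * B_LG n"
    by (rule annuls_factor[OF _ fact H(1,3)]) (use assms(1) in auto)
  have "invertible_mat P"
    using vec_space.left_factor_invertible[OF P(1) B_LG_carrier] H(2) P(2) by simp
  then show "\<exists>P\<in>carrier_mat ?R ?R. invertible_mat P \<and> H = P * B_LG n" using P by blast
qed

end
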